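(* Let $K\subset\mathbb R^n$ be an origin-symmetric convex body with $rB_2\subseteq K\subseteq RB_2$, put $\tilde d=2R$, and let $\sigma>0$. Suppose Procedure SDP (described in the context) is given as input $K$, a value $m\in\{0,\dots,n\}$ for which $d_m(K)\le L\kappa^{-1/2}\tilde d/c$ for a constant $L>0$, and an oracle $\mathcal O_K$ which, on input a symmetric psd matrix $X$, outputs $\mathcal O_K(X)\in K$ satisfying $$\mathcal O_K(X)^\top X\,\mathcal O_K(X)\ge\kappa^{-1}\max_{p\in K}p^\top Xp$$ with probability at least $1-q$, where $\kappa=\kappa(K)\ge1$, $q=\dfrac{M^{-1}}{1+\tilde d^3/\sigma^3}$ and $M$ is the number of iterations of the procedure. Then the procedure outputs a matrix $X^{\star\star}$ which satisfies, up to an absolute constant factor, $$\sup_{p\in K}p^\top X^{\star\star}p\lesssim\tilde d^2/c^2$$ with probability at least $1-(1+\tilde d^3/\sigma^3)^{-1}$.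
   Context: $B_2$ is the unit Euclidean ball; $a\vee b$ is the maximum. The constant $c$ is a fixed sufficiently large absolute constant (the one used to define local metric entropy in the paper), and $C$ below is an absolute constant taken sufficiently large (relative to $c$). Kolmogorov width: $d_m(K)=\inf_{P}\sup_{\theta\in K}\|\theta-P\theta\|_2$, the infimum over orthogonal projections $P$ of $\mathbb R^n$ onto $m$-dimensional subspaces. Procedure SDP (projected sub-gradient descent for $\min_X\max_{p\in K}p^\top Xp$ subject to $X=X^\top$, $0\le X\le I$, $\mathrm{tr}(X)=n-m$). Put $\gamma=1/(\kappa C^2)$, $M=1\vee\lceil4(n-m)C^4\kappa^2\rceil$, $X^{(1)}=\frac{n-m}{n}I_n$. If $m=n$, return $X^{\star\star}=X^{(1)}$. For $k=1,\dots,M$: let $p_k=\mathcal O_K(X^{(k)})$ and $\gamma_k=\gamma/\|p_k\|_2^2$; eigendecompose $X^{(k)}-\gamma_kp_kp_k^\top=U\Lambda U^\top$; let $v$ be the Euclidean projection of $\mathrm{diag}(\Lambda)$ onto $\{w\in\mathbb R^n:0\le w_i\le1,\ \sum_iw_i=n-m\}$; set $X^{(k+1)}=U\,\mathrm{diag}(v)U^\top$. Return $X^{\star\star}=\sum_{k=1}^M\gamma_kX^{(k)}/\sum_{k=1}^M\gamma_k$. *)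

theory Defs
  imports "Jordan_Normal_Form.DL_Rank" "HOL-Probability.Probability"
begin

(* The dimension n has to be quantified inside the statement (the constants must not depend
   on it), so R^n is carrier_vec n and the n x n matrices are carrier_mat n n.  The vector
   and matrix notation of HOL-Analysis, which is indexed by types, is switched off. *)
unbundle no vec_syntax
unbundle no inner_syntax
hide_type (open) Finite_Cartesian_Product.vec
hide_const (open) Finite_Cartesian_Product.vec Finite_Cartesian_Product.mat
  Finite_Cartesian_Product.row Finite_Cartesian_Product.column Determinants.det

definition vnorm :: "real vec \<Rightarrow> real" where
  "vnorm v = sqrt (v \<bullet> v)"

definition euclid_ball :: "nat \<Rightarrow> real \<Rightarrow> real vec set" where
  "euclid_ball n r = {v \<in> carrier_vec n. vnorm v \<le> r}"

definition quad :: "real mat \<Rightarrow> real vec \<Rightarrow> real" where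
  "quad X p = p \<bullet> (X *\<^sub>v p)"

definition psd_mat :: "nat \<Rightarrow> real mat \<Rightarrow> bool" where
  "psd_mat n X \<longleftrightarrow> X \<in> carrier_mat n n \<and> transpose_mat X = X \<and>
     (\<forall>v \<in> carrier_vec n. 0 \<le> quad X v)"

(* Coordinate maps into function spaces with the product topology.  Restricted to
   carrier_vec n and carrier_mat n n they are homeomorphisms onto closed subspaces, and they
   carry the topology and the Borel sets of R^n and R^(n x n). *)

definition vec_coords :: "nat \<Rightarrow> real vec \<Rightarrow> nat \<Rightarrow> real" where
  "vec_coords n v = (\<lambda>i. if i < n then v $ i else 0)"

definition mat_coords :: "nat \<Rightarrow> real mat \<Rightarrow> nat \<times> nat \<Rightarrow> real" where
  "mat_coords n X = (\<lambda>(i, j). if i < n \<and> j < n then X $$ (i, j) else 0)"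

definition vec_borel :: "nat \<Rightarrow> real vec measure" where
  "vec_borel n = vimage_algebra (carrier_vec n) (vec_coords n) borel"

definition psd_borel :: "nat \<Rightarrow> real mat measure" where
  "psd_borel n = vimage_algebra {X. psd_mat n X} (mat_coords n) borel"

definition convex_body :: "nat \<Rightarrow> real vec set \<Rightarrow> bool" where
  "convex_body n K \<longleftrightarrow> K \<subseteq> carrier_vec n \<and>
     (\<forall>x\<in>K. \<forall>y\<in>K. \<forall>t\<in>{0..1}. t \<cdot>\<^sub>v x + (1 - t) \<cdot>\<^sub>v y \<in> K) \<and>
     compact (vec_coords n ` K) \<and>
     (\<exists>x \<in> carrier_vec n. \<exists>\<epsilon>>0. \<forall>y \<in> euclid_ball n \<epsilon>. x + y \<in> K)"

definition origin_symmetric :: "real vec set \<Rightarrow> bool" where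
  "origin_symmetric K \<longleftrightarrow> (\<forall>x\<in>K. - x \<in> K)"

definition orth_projections :: "nat \<Rightarrow> nat \<Rightarrow> real mat set" where
  "orth_projections n m = {P \<in> carrier_mat n n. transpose_mat P = P \<and> P * P = P \<and>
     vec_space.rank n P = m}"

definition kolmogorov_width :: "nat \<Rightarrow> nat \<Rightarrow> real vec set \<Rightarrow> real" where
  "kolmogorov_width n m K =
     (INF P \<in> orth_projections n m. SUP \<theta> \<in> K. vnorm (\<theta> - P *\<^sub>v \<theta>))"

definition sdp_iterations :: "nat \<Rightarrow> nat \<Rightarrow> real \<Rightarrow> real \<Rightarrow> nat" where
  "sdp_iterations n m \<kappa> C = max 1 (nat \<lceil>4 * (real n - real m) * C ^ 4 * \<kappa>\<^sup>2\<rceil>)"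

definition sdp_gamma :: "real \<Rightarrow> real \<Rightarrow> real" where
  "sdp_gamma \<kappa> C = 1 / (\<kappa> * C\<^sup>2)"

(* If p = 0 this is 0, by the convention x / 0 = 0, and the iteration leaves X unchanged. *)
definition sdp_stepsize :: "real \<Rightarrow> real \<Rightarrow> real vec \<Rightarrow> real" where
  "sdp_stepsize \<kappa> C p = sdp_gamma \<kappa> C / (vnorm p)\<^sup>2"

definition outer :: "nat \<Rightarrow> real vec \<Rightarrow> real mat" where
  "outer n p = mat n n (\<lambda>(i, j). p $ i * p $ j)"

definition eigendecomposition :: "nat \<Rightarrow> real mat \<Rightarrow> real mat \<Rightarrow> real vec \<Rightarrow> bool" where
  "eigendecomposition n Y U l \<longleftrightarrow> U \<in> carrier_mat n n \<and> l \<in> carrier_vec n \<and>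
     transpose_mat U * U = 1\<^sub>m n \<and> Y = U * mat_diag n (\<lambda>i. l $ i) * transpose_mat U"

definition capped_simplex :: "nat \<Rightarrow> nat \<Rightarrow> real vec set" where
  "capped_simplex n m = {w \<in> carrier_vec n. (\<forall>i<n. 0 \<le> w $ i \<and> w $ i \<le> 1) \<and>
     (\<Sum>i<n. w $ i) = real n - real m}"

definition is_euclidean_projection :: "real vec set \<Rightarrow> real vec \<Rightarrow> real vec \<Rightarrow> bool" where
  "is_euclidean_projection W l v \<longleftrightarrow> v \<in> W \<and> (\<forall>w\<in>W. vnorm (l - v) \<le> vnorm (l - w))"

(* A relation, because the eigendecomposition is not unique; any choice is allowed. *)
definition sdp_step ::
  "nat \<Rightarrow> nat \<Rightarrow> real \<Rightarrow> real \<Rightarrow> real mat \<Rightarrow> real vec \<Rightarrow> real mat \<Rightarrow> bool" where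
  "sdp_step n m \<kappa> C X p X' \<longleftrightarrow>
     (\<exists>U l v. eigendecomposition n (X - sdp_stepsize \<kappa> C p \<cdot>\<^sub>m outer n p) U l \<and>
        is_euclidean_projection (capped_simplex n m) l v \<and>
        X' = U * mat_diag n (\<lambda>i. v $ i) * transpose_mat U)"

(* orc k is the (realized) map that answers the oracle call of iteration k, and X k is the
   k-th iterate, both counted from 1. *)
definition sdp_run ::
  "nat \<Rightarrow> nat \<Rightarrow> real \<Rightarrow> real \<Rightarrow> (nat \<Rightarrow> real mat \<Rightarrow> real vec) \<Rightarrow> (nat \<Rightarrow> real mat) \<Rightarrow> bool" where
  "sdp_run n m \<kappa> C orc X \<longleftrightarrow>
     X 1 = ((real n - real m) / real n) \<cdot>\<^sub>m 1\<^sub>m n \<and>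
     (m \<noteq> n \<longrightarrow> (\<forall>k \<in> {1..sdp_iterations n m \<kappa> C}.
        sdp_step n m \<kappa> C (X k) (orc k (X k)) (X (Suc k))))"

definition sdp_output ::
  "nat \<Rightarrow> nat \<Rightarrow> real \<Rightarrow> real \<Rightarrow> (nat \<Rightarrow> real mat \<Rightarrow> real vec) \<Rightarrow> (nat \<Rightarrow> real mat) \<Rightarrow> real mat" where
  "sdp_output n m \<kappa> C orc X =
     (if m = n then X 1
      else let N = sdp_iterations n m \<kappa> C; \<gamma> = (\<lambda>k. sdp_stepsize \<kappa> C (orc k (X k)))
        in mat n n (\<lambda>(i, j). (\<Sum>k = 1..N. \<gamma> k * X k $$ (i, j)) / (\<Sum>k = 1..N. \<gamma> k)))"

(* A randomized oracle is a random map: S is a probability measure on maps, and a call draws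
   f from S, independently of everything before, and answers f X.  The answer always lies in K;
   the approximation guarantee fails with probability at most q for each fixed input X. *)
definition randomized_oracle ::
  "nat \<Rightarrow> real vec set \<Rightarrow> real \<Rightarrow> real \<Rightarrow> (real mat \<Rightarrow> real vec) measure \<Rightarrow> bool" where
  "randomized_oracle n K \<kappa> q S \<longleftrightarrow> prob_space S \<and>
     (\<lambda>(f, X). f X) \<in> measurable (S \<Otimes>\<^sub>M psd_borel n) (vec_borel n) \<and>
     (\<forall>f \<in> space S. \<forall>X. psd_mat n X \<longrightarrow> f X \<in> K) \<and>
     (\<forall>X. psd_mat n X \<longrightarrow>
        \<P>(f in S. quad X (f X) \<ge> inverse \<kappa> * (SUP p \<in> K. quad X p)) \<ge> 1 - q)"

(* The maps answering the oracle calls of one execution: independent draws from S. *)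
definition oracle_calls ::
  "nat \<Rightarrow> (real mat \<Rightarrow> real vec) measure \<Rightarrow> (nat \<Rightarrow> real mat \<Rightarrow> real vec) measure" where
  "oracle_calls N S = (\<Pi>\<^sub>M k \<in> {1..N}. S)"

end

theory Submission
  imports Defs
begin

text \<open>
  One step of the procedure is a projected sub-gradient step: \<open>U diag(v) U\<^sup>T\<close> is the Frobenius
  projection of \<open>X - \<gamma>\<^sub>k p p\<^sup>T\<close> onto the set of symmetric matrices with \<open>0 \<le> W \<le> I\<close> and trace
  \<open>n - m\<close>. The usual telescoping of \<open>\<parallel>X\<^sup>(\<^sup>k\<^sup>) - W\<parallel>\<^sup>2\<close>, with \<open>W = I - P\<close> for a nearly
  optimal projection \<open>P\<close> in the Kolmogorov width, bounds \<open>\<Sum>\<^sub>k \<gamma>\<^sub>k p\<^sub>k\<^sup>T X\<^sup>(\<^sup>k\<^sup>) p\<^sub>k\<close>, and the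
  approximation guarantee loses a factor \<open>\<kappa>\<close> that the hypothesis on the width absorbs.
  Since projections are unique and nonexpansive, the \<open>k\<close>-th iterate is a measurable function of the
  first \<open>k - 1\<close> oracle draws, whatever eigendecompositions are chosen. The \<open>k\<close>-th draw is
  independent of it and fails with probability at most \<open>q\<close>; a union bound concludes.
\<close>

section \<open>Quadratic forms and the fantope\<close>

lemma scalar_prod_sum: "w \<in> carrier_vec n \<Longrightarrow> v \<bullet> w = (\<Sum>i<n. v $ i * w $ i)"
  by (simp add: scalar_prod_def atLeast0LessThan)

lemma scalar_prod_self_nonneg: "0 \<le> v \<bullet> (v :: real vec)"
  by (auto simp: scalar_prod_def intro: sum_nonneg)

lemma vnorm_power2: "(vnorm v)\<^sup>2 = v \<bullet> v"
  by (simp add: vnorm_def scalar_prod_self_nonneg)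

lemma vnorm_nonneg [simp]: "0 \<le> vnorm v"
  by (simp add: vnorm_def scalar_prod_self_nonneg)

lemma vnorm_power2_diff:
  assumes "v \<in> carrier_vec n" "w \<in> carrier_vec n"
  shows "(vnorm (v - w))\<^sup>2 = (\<Sum>i<n. (v $ i - w $ i)\<^sup>2)"
  unfolding vnorm_power2 using assms by (simp add: scalar_prod_def power2_eq_square atLeast0LessThan)

text \<open>The Frobenius inner product. Summing over index pairs lets the projection estimates
  below, stated for functions on an index set, apply verbatim to matrices.\<close>

definition mat_inner :: "nat \<Rightarrow> real mat \<Rightarrow> real mat \<Rightarrow> real" where
  "mat_inner n A B = (\<Sum>x\<in>{..<n} \<times> {..<n}. A $$ x * B $$ x)"

lemma mat_inner_double_sum: "mat_inner n A B = (\<Sum>i<n. \<Sum>j<n. A $$ (i, j) * B $$ (i, j))"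
  unfolding mat_inner_def sum.cartesian_product by (rule sum.cong) auto

lemma mat_inner_commute: "mat_inner n A B = mat_inner n B A"
  by (simp add: mat_inner_def mult.commute)

text \<open>Exhibits the form as linear in \<open>X\<close>: \<open>outer n p\<close> is its
  gradient with respect to \<open>X\<close>, hence the direction of the sub-gradient step.\<close>

lemma quad_eq_mat_inner:
  assumes X: "X \<in> carrier_mat n n" and p: "p \<in> carrier_vec n"
  shows "quad X p = mat_inner n X (outer n p)"
proof -
  have "quad X p = (\<Sum>i<n. p $ i * (\<Sum>j<n. X $$ (i, j) * p $ j))"
    using assms by (simp add: quad_def scalar_prod_def atLeast0LessThan)
  also have "\<dots> = (\<Sum>i<n. \<Sum>j<n. X $$ (i, j) * outer n p $$ (i, j))"
    by (simp add: sum_distrib_left outer_def mult_ac)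
  finally show ?thesis
    by (simp add: mat_inner_double_sum)
qed

lemma mat_inner_outer_self:
  assumes p: "p \<in> carrier_vec n"
  shows "mat_inner n (outer n p) (outer n p) = vnorm p ^ 4"
proof -
  have "mat_inner n (outer n p) (outer n p) = (\<Sum>i<n. \<Sum>j<n. (p $ i * p $ i) * (p $ j * p $ j))"
    unfolding mat_inner_double_sum by (intro sum.cong refl) (simp add: outer_def algebra_simps)
  also have "\<dots> = (p \<bullet> p) * (p \<bullet> p)"
    by (simp add: scalar_prod_sum[OF p] sum_product)
  also have "\<dots> = (vnorm p)\<^sup>2 * (vnorm p)\<^sup>2"
    by (simp only: vnorm_power2)
  finally show ?thesis
    by (simp add: power_add[symmetric])
qed

lemma conj_diag_carrier [simp]:
  "U \<in> carrier_mat n n \<Longrightarrow> U * mat_diag n d * transpose_mat U \<in> carrier_mat n n"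
  by (intro mult_carrier_mat) auto

lemma index_conj_diag:
  fixes U :: "real mat"
  assumes U: "U \<in> carrier_mat n n" and "i < n" "j < n"
  shows "(U * mat_diag n d * transpose_mat U) $$ (i, j) = (\<Sum>k<n. d k * (U $$ (i, k) * U $$ (j, k)))"
  using assms
  by (auto simp: mat_diag_mult_right[OF U] scalar_prod_def atLeast0LessThan mult_ac intro!: sum.cong)

text \<open>\<open>U diag(d) U^T\<close> is the sum of the rank-one matrices \<open>d k\<close>
  times \<open>u_k u_k^T\<close>, with \<open>u_k\<close> the k-th column of \<open>U\<close>, so
  pairing with it sees only the diagonal values of \<open>W\<close> along these columns. This
  reduces matrix statements to statements on eigenvalue vectors.\<close>

lemma mat_inner_conj_diag:
  assumes U: "U \<in> carrier_mat n n" and W: "W \<in> carrier_mat n n"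
  shows "mat_inner n W (U * mat_diag n d * transpose_mat U) = (\<Sum>k<n. d k * quad W (col U k))"
proof -
  have "mat_inner n W (U * mat_diag n d * transpose_mat U)
      = (\<Sum>i<n. \<Sum>j<n. \<Sum>k<n. d k * (W $$ (i, j) * (U $$ (i, k) * U $$ (j, k))))"
    unfolding mat_inner_double_sum
    by (simp add: index_conj_diag[OF U] sum_distrib_left mult_ac)
  also have "\<dots> = (\<Sum>i<n. \<Sum>k<n. \<Sum>j<n. d k * (W $$ (i, j) * (U $$ (i, k) * U $$ (j, k))))"
    by (rule sum.cong[OF refl]) (rule sum.swap)
  also have "\<dots> = (\<Sum>k<n. \<Sum>i<n. \<Sum>j<n. d k * (W $$ (i, j) * (U $$ (i, k) * U $$ (j, k))))"
    by (rule sum.swap)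
  also have "\<dots> = (\<Sum>k<n. d k * quad W (col U k))"
  proof (rule sum.cong[OF refl])
    fix k assume "k \<in> {..<n}"
    then have "quad W (col U k) = (\<Sum>i<n. \<Sum>j<n. W $$ (i, j) * (U $$ (i, k) * U $$ (j, k)))"
      using U by (subst quad_eq_mat_inner[OF W]) (auto simp: mat_inner_double_sum outer_def intro!: sum.cong)
    then show "(\<Sum>i<n. \<Sum>j<n. d k * (W $$ (i, j) * (U $$ (i, k) * U $$ (j, k)))) = d k * quad W (col U k)"
      by (simp add: sum_distrib_left)
  qed
  finally show ?thesis .
qed

text \<open>The feasible set of the semidefinite program; for \<open>m \<le> n\<close> it is the
  convex hull of the orthogonal projections of rank \<open>n - m\<close>. The constraints
  \<open>0 \<le> W \<le> I\<close> are tested on quadratic forms, so eigenvalues of \<open>W\<close>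
  need not be named.\<close>

definition fantope :: "nat \<Rightarrow> nat \<Rightarrow> real mat set" where
  "fantope n m = {W \<in> carrier_mat n n. transpose_mat W = W \<and>
     (\<forall>v \<in> carrier_vec n. 0 \<le> quad W v \<and> quad W v \<le> v \<bullet> v) \<and>
     (\<Sum>i<n. W $$ (i, i)) = real n - real m}"

lemma fantope_carrier: "W \<in> fantope n m \<Longrightarrow> W \<in> carrier_mat n n"
  by (simp add: fantope_def)

lemma fantope_psd: "W \<in> fantope n m \<Longrightarrow> psd_mat n W"
  by (simp add: fantope_def psd_mat_def)

lemma mat_inner_one:
  "mat_inner n W (1\<^sub>m n) = (\<Sum>i<n. W $$ (i, i))"
proof -
  have "(\<Sum>j<n. W $$ (i, j) * 1\<^sub>m n $$ (i, j)) = W $$ (i, i)" if "i < n" for i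
    using that by (subst sum.remove[of _ i]) (auto intro!: sum.neutral)
  then show ?thesis by (simp add: mat_inner_double_sum)
qed

section \<open>Diagonals in the orthonormal basis of columns of \<open>U\<close>\<close>

context
  fixes n :: nat and U :: "real mat"
  assumes U: "U \<in> carrier_mat n n" and orth: "transpose_mat U * U = 1\<^sub>m n"
begin

lemma orth_right: "U * transpose_mat U = 1\<^sub>m n"
  using mat_mult_left_right_inverse[OF _ U orth] U by simp

lemma col_orthonormal: "i < n \<Longrightarrow> j < n \<Longrightarrow> col U i \<bullet> col U j = (if i = j then 1 else 0)"
  using arg_cong[OF orth, of "\<lambda>A. A $$ (i, j)"] U by simp

text \<open>Basis invariance of the trace: with \<open>d = 1\<close> the conjugated diagonal matrix
  is \<open>U U^T = I\<close>.\<close>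

lemma sum_quad_col:
  assumes W: "W \<in> carrier_mat n n"
  shows "(\<Sum>k<n. quad W (col U k)) = (\<Sum>i<n. W $$ (i, i))"
  using mat_inner_conj_diag[OF U W, of "\<lambda>_. 1"] orth_right U by (simp add: mat_inner_one)

text \<open>The columns are unit vectors, so \<open>0 \<le> W \<le> I\<close> bounds each diagonal
  value, and the trace does not depend on the basis.\<close>

lemma fantope_diagonal:
  assumes W: "W \<in> fantope n m"
  shows "vec n (\<lambda>k. quad W (col U k)) \<in> capped_simplex n m"
proof -
  have "0 \<le> quad W (col U k) \<and> quad W (col U k) \<le> 1" if "k < n" for k
  proof -
    have "col U k \<in> carrier_vec n"
      using U by auto
    then have "0 \<le> quad W (col U k)" "quad W (col U k) \<le> col U k \<bullet> col U k"
      using W by (auto simp: fantope_def)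
    then show ?thesis
      using col_orthonormal[OF that that] by simp
  qed
  then show ?thesis
    using sum_quad_col[OF fantope_carrier[OF W]] W by (simp add: capped_simplex_def fantope_def)
qed

lemma quad_conj_diag:
  assumes p: "p \<in> carrier_vec n"
  shows "quad (U * mat_diag n d * transpose_mat U) p = (\<Sum>k<n. d k * (col U k \<bullet> p)\<^sup>2)"
proof -
  have c: "U * mat_diag n d * transpose_mat U \<in> carrier_mat n n"
    using U by simp
  have o: "outer n p \<in> carrier_mat n n"
    by (simp add: outer_def)
  have "quad (outer n p) (col U k) = (col U k \<bullet> p)\<^sup>2" if "k < n" for k
    using that U p
    by (subst quad_eq_mat_inner[OF o])
      (auto simp: mat_inner_double_sum outer_def scalar_prod_sum[OF p] power2_eq_square sum_product
        mult_ac intro!: sum.cong)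
  then show ?thesis
    unfolding quad_eq_mat_inner[OF c p] mat_inner_commute[of n "U * _ * _"]
    by (simp add: mat_inner_conj_diag[OF U o])
qed

lemma quad_conj_diag_col:
  assumes "k < n"
  shows "quad (U * mat_diag n d * transpose_mat U) (col U k) = d k"
proof -
  have "quad (U * mat_diag n d * transpose_mat U) (col U k)
      = (\<Sum>i<n. d i * (col U i \<bullet> col U k)\<^sup>2)"
    using U assms by (intro quad_conj_diag) auto
  also have "\<dots> = (\<Sum>i<n. if i = k then d k else 0)"
    by (intro sum.cong) (auto simp: col_orthonormal assms)
  finally show ?thesis
    using assms by simp
qed

text \<open>In the basis of columns the form is a sum of squared coefficients with weights in
  \<open>[0, 1]\<close>, and by Parseval (the case \<open>d = 1\<close>) the unweighted sum is
  \<open>p \<bullet> p\<close>.\<close>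

lemma conj_diag_in_fantope:
  assumes v: "v \<in> capped_simplex n m"
  shows "U * mat_diag n (\<lambda>i. v $ i) * transpose_mat U \<in> fantope n m"
proof -
  let ?X = "U * mat_diag n (\<lambda>i. v $ i) * transpose_mat U"
  have c: "?X \<in> carrier_mat n n"
    using U by simp
  have "transpose_mat ?X = ?X"
    by (rule eq_matI) (use U c in \<open>auto simp: index_conj_diag[OF U] mult_ac simp del: index_mult_mat(1)\<close>)
  moreover have "0 \<le> quad ?X p \<and> quad ?X p \<le> p \<bullet> p" if p: "p \<in> carrier_vec n" for p
  proof -
    have "p \<bullet> p = (\<Sum>k<n. (col U k \<bullet> p)\<^sup>2)"
      using quad_conj_diag[OF p, of "\<lambda>_. 1"] orth_right U p by (simp add: quad_def)
    then show ?thesis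
      unfolding quad_conj_diag[OF p] using v
      by (auto simp: capped_simplex_def intro!: sum_nonneg sum_mono mult_left_le_one_le)
  qed
  moreover have "(\<Sum>i<n. ?X $$ (i, i)) = real n - real m"
    using v by (simp add: sum_quad_col[OF c, symmetric] quad_conj_diag_col capped_simplex_def)
  ultimately show ?thesis
    using c by (simp add: fantope_def)
qed

end

section \<open>Euclidean projections\<close>

text \<open>First-order optimality: moving from \<open>v\<close> towards \<open>w\<close> by
  \<open>t\<close> changes the squared distance by \<open>- 2 * t * a + t^2 * b\<close>, which is
  negative for small \<open>t\<close> if \<open>a > 0\<close>.\<close>

lemma convex_projection_variational:
  fixes l v w :: "nat \<Rightarrow> real"
  assumes min: "\<And>t. 0 < t \<Longrightarrow> t \<le> 1 \<Longrightarrow>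
      (\<Sum>i\<in>I. (l i - v i)\<^sup>2) \<le> (\<Sum>i\<in>I. (l i - ((1 - t) * v i + t * w i))\<^sup>2)"
  shows "(\<Sum>i\<in>I. (l i - v i) * (w i - v i)) \<le> 0"
proof (rule ccontr)
  define a where "a = (\<Sum>i\<in>I. (l i - v i) * (w i - v i))"
  define b where "b = (\<Sum>i\<in>I. (w i - v i)\<^sup>2)"
  assume "\<not> (\<Sum>i\<in>I. (l i - v i) * (w i - v i)) \<le> 0"
  then have a: "a > 0" by (simp add: a_def)
  have b: "b \<ge> 0" by (simp add: b_def sum_nonneg)
  have bound: "2 * a \<le> t * b" if t: "0 < t" "t \<le> 1" for t
  proof -
    have "(\<Sum>i\<in>I. (l i - ((1 - t) * v i + t * w i))\<^sup>2)
        = (\<Sum>i\<in>I. (l i - v i)\<^sup>2 - 2 * t * ((l i - v i) * (w i - v i)) + t\<^sup>2 * (w i - v i)\<^sup>2)"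
      by (rule sum.cong) (simp_all add: power2_eq_square algebra_simps)
    also have "\<dots> = (\<Sum>i\<in>I. (l i - v i)\<^sup>2) - 2 * t * a + t\<^sup>2 * b"
      by (simp add: sum.distrib sum_subtractf sum_distrib_left a_def b_def)
    finally have "t * (2 * a) \<le> t * (t * b)"
      using min[OF t] by (simp add: power2_eq_square algebra_simps)
    then show ?thesis using t by simp
  qed
  \<comment> \<open>Chosen so that \<open>t * b \<le> a\<close>, which contradicts
    \<open>2 * a \<le> t * b\<close>; the summand 1 keeps the quotient meaningful when
    \<open>b = 0\<close>.\<close>
  define t where "t = min 1 (a / (b + 1))"
  have t: "0 < t" "t \<le> 1" using a b by (auto simp: t_def)
  have "t * b \<le> a / (b + 1) * b"
    using b by (intro mult_right_mono) (auto simp: t_def)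
  also have "\<dots> \<le> a"
    using a b by (simp add: field_simps)
  finally show False using bound[OF t] a by simp
qed

text \<open>The capped simplex is convex, so every point of the segment from \<open>v\<close> to
  \<open>w\<close> competes with \<open>v\<close>.\<close>

lemma capped_simplex_projection_variational:
  assumes proj: "is_euclidean_projection (capped_simplex n m) l v" and l: "l \<in> carrier_vec n"
    and w: "w \<in> capped_simplex n m"
  shows "(\<Sum>i<n. (l $ i - v $ i) * (w $ i - v $ i)) \<le> 0"
proof (rule convex_projection_variational)
  fix t :: real assume t: "0 < t" "t \<le> 1"
  let ?u = "vec n (\<lambda>i. (1 - t) * v $ i + t * w $ i)"
  have v: "v \<in> capped_simplex n m"
    using proj by (simp add: is_euclidean_projection_def)
  have "(\<Sum>i<n. (1 - t) * v $ i + t * w $ i) = (1 - t) * (\<Sum>i<n. v $ i) + t * (\<Sum>i<n. w $ i)"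
    by (simp add: sum.distrib sum_distrib_left)
  also have "\<dots> = real n - real m"
  proof -
    have "(\<Sum>i<n. v $ i) = real n - real m" "(\<Sum>i<n. w $ i) = real n - real m"
      using v w by (auto simp: capped_simplex_def)
    then show ?thesis
      by (simp only:) (simp add: algebra_simps)
  qed
  finally have "?u \<in> capped_simplex n m"
    using v w t by (auto simp: capped_simplex_def intro!: convex_bound_le)
  then have "(vnorm (l - v))\<^sup>2 \<le> (vnorm (l - ?u))\<^sup>2"
    using proj by (intro power_mono) (auto simp: is_euclidean_projection_def)
  then show "(\<Sum>i<n. (l $ i - v $ i)\<^sup>2) \<le> (\<Sum>i<n. (l $ i - ((1 - t) * v $ i + t * w $ i))\<^sup>2)"
    using l v by (simp add: vnorm_power2_diff[where n = n] capped_simplex_def)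
qed

text \<open>In the eigenbasis of \<open>Y = X - \<gamma>\<^sub>k p p\<^sup>T\<close>, the diagonal of any matrix of the fantope lies in the
  capped simplex, so the variational inequality of the projection of the eigenvalues yields the one
  for matrices.\<close>

lemma sdp_step_projection:
  assumes X: "X \<in> carrier_mat n n" and step: "sdp_step n m \<kappa> C X p X'"
  shows "X' \<in> fantope n m"
    and "W \<in> fantope n m \<Longrightarrow>
      (\<Sum>x\<in>{..<n} \<times> {..<n}. (X $$ x - sdp_stepsize \<kappa> C p * outer n p $$ x - X' $$ x) *
          (W $$ x - X' $$ x)) \<le> 0"
proof -
  let ?Y = "X - sdp_stepsize \<kappa> C p \<cdot>\<^sub>m outer n p"
  from step obtain U l v where dec: "eigendecomposition n ?Y U l"
    and proj: "is_euclidean_projection (capped_simplex n m) l v"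
    and X': "X' = U * mat_diag n (\<lambda>i. v $ i) * transpose_mat U"
    unfolding sdp_step_def by blast
  from dec have U: "U \<in> carrier_mat n n" and l: "l \<in> carrier_vec n"
    and orth: "transpose_mat U * U = 1\<^sub>m n"
    and Y: "?Y = U * mat_diag n (\<lambda>i. l $ i) * transpose_mat U"
    by (auto simp: eigendecomposition_def)
  have v: "v \<in> capped_simplex n m"
    using proj by (simp add: is_euclidean_projection_def)
  show X'f: "X' \<in> fantope n m"
    unfolding X' by (rule conj_diag_in_fantope[OF U orth v])
  note X'c = fantope_carrier[OF X'f]
  assume W: "W \<in> fantope n m"
  note Wc = fantope_carrier[OF W]
  have "(\<Sum>x\<in>{..<n} \<times> {..<n}. (X $$ x - sdp_stepsize \<kappa> C p * outer n p $$ x - X' $$ x) *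
      (W $$ x - X' $$ x)) = (\<Sum>x\<in>{..<n} \<times> {..<n}. (?Y $$ x - X' $$ x) * (W $$ x - X' $$ x))"
    using X by (intro sum.cong) (auto simp: outer_def)
  also have "\<dots> = mat_inner n W ?Y - mat_inner n X' ?Y - (mat_inner n W X' - mat_inner n X' X')"
    by (simp add: mat_inner_def sum_subtractf algebra_simps)
  also have "mat_inner n W ?Y = (\<Sum>k<n. l $ k * quad W (col U k))"
    unfolding Y by (rule mat_inner_conj_diag[OF U Wc])
  also have "mat_inner n X' ?Y = (\<Sum>k<n. l $ k * quad X' (col U k))"
    unfolding Y by (rule mat_inner_conj_diag[OF U X'c])
  also have "mat_inner n W X' = (\<Sum>k<n. v $ k * quad W (col U k))"
    by (subst X') (rule mat_inner_conj_diag[OF U Wc])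
  also have "mat_inner n X' X' = (\<Sum>k<n. v $ k * quad X' (col U k))"
    by (subst (2) X') (rule mat_inner_conj_diag[OF U X'c])
  \<comment> \<open>The diagonal of \<open>X'\<close> in its own eigenbasis is \<open>v\<close>, so
    the four pairings combine into the variational expression for vectors.\<close>
  also have "(\<Sum>k<n. l $ k * quad W (col U k)) - (\<Sum>k<n. l $ k * quad X' (col U k)) -
      ((\<Sum>k<n. v $ k * quad W (col U k)) - (\<Sum>k<n. v $ k * quad X' (col U k)))
      = (\<Sum>k<n. (l $ k - v $ k) * (vec n (\<lambda>k. quad W (col U k)) $ k - v $ k))"
    by (simp add: X' quad_conj_diag_col[OF U orth] sum_subtractf algebra_simps)
  also have "\<dots> \<le> 0"
    by (rule capped_simplex_projection_variational[OF proj l fantope_diagonal[OF U orth W]])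
  finally show "(\<Sum>x\<in>{..<n} \<times> {..<n}. (X $$ x - sdp_stepsize \<kappa> C p * outer n p $$ x - X' $$ x) *
      (W $$ x - X' $$ x)) \<le> 0" .
qed

text \<open>Expand \<open>|d|^2 = |e|^2 + |d - e|^2 + 2 <e, d - e>\<close> with
  \<open>d = y1 - y2\<close> and \<open>e = p1 - p2\<close>; the cross term is minus twice the sum
  of the two variational expressions, hence nonnegative.\<close>

lemma projection_nonexpansive:
  fixes y1 y2 p1 p2 :: "'i \<Rightarrow> real"
  assumes "(\<Sum>x\<in>I. (y1 x - p1 x) * (p2 x - p1 x)) \<le> 0" "(\<Sum>x\<in>I. (y2 x - p2 x) * (p1 x - p2 x)) \<le> 0"
  shows "(\<Sum>x\<in>I. (p1 x - p2 x)\<^sup>2) \<le> (\<Sum>x\<in>I. (y1 x - y2 x)\<^sup>2)"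
proof -
  have "(\<Sum>x\<in>I. (y1 x - y2 x)\<^sup>2) = (\<Sum>x\<in>I. (p1 x - p2 x)\<^sup>2 + (y1 x - y2 x - (p1 x - p2 x))\<^sup>2
      - 2 * ((y1 x - p1 x) * (p2 x - p1 x)) - 2 * ((y2 x - p2 x) * (p1 x - p2 x)))"
    by (rule sum.cong) (simp_all add: power2_eq_square algebra_simps)
  also have "\<dots> = (\<Sum>x\<in>I. (p1 x - p2 x)\<^sup>2) + (\<Sum>x\<in>I. (y1 x - y2 x - (p1 x - p2 x))\<^sup>2)
      - 2 * (\<Sum>x\<in>I. (y1 x - p1 x) * (p2 x - p1 x)) - 2 * (\<Sum>x\<in>I. (y2 x - p2 x) * (p1 x - p2 x))"
    by (simp add: sum.distrib sum_subtractf sum_distrib_left)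
  also have "\<dots> \<ge> (\<Sum>x\<in>I. (p1 x - p2 x)\<^sup>2)"
    using assms sum_nonneg[of I "\<lambda>x. (y1 x - y2 x - (p1 x - p2 x))\<^sup>2"] by simp
  finally show ?thesis .
qed

text \<open>The comparison point \<open>w\<close> is its own projection, which makes its variational
  expression vanish.\<close>

lemma projection_closer:
  fixes y p w :: "'i \<Rightarrow> real"
  assumes "(\<Sum>x\<in>I. (y x - p x) * (w x - p x)) \<le> 0"
  shows "(\<Sum>x\<in>I. (p x - w x)\<^sup>2) \<le> (\<Sum>x\<in>I. (y x - w x)\<^sup>2)"
  using projection_nonexpansive[of y p w I w] assms by simp

section \<open>Orthogonal projections and the Kolmogorov width\<close>

text \<open>Write \<open>P = A B\<close>, where the columns of \<open>A\<close> are a basis of the column space of \<open>P\<close>. Then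
  \<open>A B A = P A = A\<close>, hence \<open>B A = I\<close>, and \<open>tr (A B) = tr (B A) = m\<close>.\<close>

lemma trace_orth_projection:
  assumes P: "P \<in> orth_projections n m"
  shows "(\<Sum>i<n. P $$ (i, i)) = real m"
proof -
  interpret vec_space "TYPE(real)" n .
  from P have Pc: "P \<in> carrier_mat n n" and idem: "P * P = P" and rk: "rank P = m"
    by (auto simp: orth_projections_def)
  have cP: "set (cols P) \<subseteq> carrier_vec n"
    using cols_dim[of P] Pc by simp
  let ?indpt = "\<lambda>T. T \<subseteq> set (cols P) \<and> lin_indpt T"
  \<comment> \<open>A maximal independent set of columns exists by growing the empty set; its
    cardinality is the rank.\<close>
  have "\<exists>S. finite S \<and> maximal S ?indpt \<and> {} \<subseteq> S"
    by (rule maximal_exists_superset[of "set (cols P)"]) (auto simp: lin_dep_def)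
  then obtain S where fS: "finite S" and maxS: "maximal S ?indpt" by blast
  have S: "S \<subseteq> set (cols P)" "lin_indpt S"
    using maxS by (auto simp: maximal_def)
  have Sc: "S \<subseteq> carrier_vec n"
    using S cP by auto
  have cardS: "card S = m"
    using rank_card_indpt[OF Pc maxS] rk by simp
  obtain us where us: "set us = S" "distinct us"
    using finite_distinct_list[OF fS] by blast
  have len: "length us = m"
    using us cardS distinct_card by force
  define A where "A = mat_of_cols n us"
  have Ac: "A \<in> carrier_mat n m"
    unfolding A_def len[symmetric] by (rule mat_of_cols_carrier)
  have colsA: "cols A = us"
    unfolding A_def using Sc us by (simp add: cols_mat_of_cols)
  have col_span: "c \<in> span S" if c: "c \<in> set (cols P)" for c
  proof (rule ccontr)
    assume nc: "c \<notin> span S"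
    then have "c \<notin> S"
      using Sc by (auto dest: in_own_span[THEN subsetD, rotated])
    moreover have "lin_indpt (insert c S)"
      using lin_dep_iff_in_span[OF _ S(2) _ \<open>c \<notin> S\<close>] nc c cP Sc by auto
    ultimately show False
      using maxS c S by (auto simp: maximal_def)
  qed
  have "\<exists>b. b \<in> carrier_vec m \<and> col P j = A *\<^sub>v b" if j: "j < n" for j
  proof -
    have "col P j \<in> span S"
      using j Pc by (intro col_span) (auto simp: cols_def)
    then obtain a where a: "col P j = lincomb a S"
      using finite_span[OF fS] Sc by auto
    have "A *\<^sub>v vec m (\<lambda>i. a (col A i)) = lincomb a (set (cols A))"
      by (rule mat_mult_eq_lincomb[OF Ac]) (simp add: colsA us)
    then show ?thesis
      using a us by (intro exI[of _ "vec m (\<lambda>i. a (col A i))"]) (simp add: colsA)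
  qed
  then obtain b where b: "\<And>j. j < n \<Longrightarrow> b j \<in> carrier_vec m" "\<And>j. j < n \<Longrightarrow> col P j = A *\<^sub>v b j"
    by metis
  define B where "B = mat m n (\<lambda>(i, j). b j $ i)"
  have Bc: "B \<in> carrier_mat m n" by (simp add: B_def)
  have colB: "col B j = b j" if "j < n" for j
    using b(1)[OF that] that by (intro eq_vecI) (auto simp: B_def)
  have AB: "P = A * B"
  proof (rule mat_col_eqI)
    show "col P j = col (A * B) j" if "j < dim_col (A * B)" for j
      using that b colB Bc by (simp add: col_mult2[OF Ac Bc])
  qed (use Pc Ac Bc in auto)
  have PA: "P * A = A"
  proof (rule mat_col_eqI)
    fix j assume "j < dim_col A"
    then have j: "j < m" using Ac by simp
    have "col A j \<in> set (cols P)"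
      using j S us len by (metis Ac carrier_matD(2) cols_nth colsA nth_mem subsetD)
    then obtain k where k: "k < n" "col A j = col P k"
      using Pc by (auto simp: cols_def)
    have "col (P * A) j = P *\<^sub>v col P k"
      using j k by (simp add: col_mult2[OF Pc Ac])
    also have "\<dots> = col (P * P) k"
      using k by (simp add: col_mult2[OF Pc Pc])
    finally show "col (P * A) j = col A j"
      using idem k by simp
  qed (use Pc Ac in auto)
  have BA: "B * A = 1\<^sub>m m"
  proof (rule mat_col_eqI)
    fix j assume "j < dim_col (1\<^sub>m m)"
    then have j: "j < m" by simp
    \<comment> \<open>The columns of \<open>A\<close> are independent, so \<open>A\<close> has
      trivial kernel and it suffices that \<open>A\<close> annihilates this difference.\<close>
    let ?v = "col (B * A) j - unit_vec m j"
    have v: "?v \<in> carrier_vec m" using Bc Ac j by auto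
    have "A *\<^sub>v col (B * A) j = col (A * (B * A)) j"
      using j by (subst col_mult2[OF Ac]) (use Ac Bc in auto)
    also have "A * (B * A) = A"
      using assoc_mult_mat[OF Ac Bc Ac] PA AB by simp
    also have "col A j = A *\<^sub>v unit_vec m j"
      using j Ac by (intro eq_vecI) (auto simp: scalar_prod_right_unit)
    finally have "A *\<^sub>v ?v = 0\<^sub>v n"
      using Ac Bc j by (subst mult_minus_distrib_mat_vec[OF Ac]) auto
    then have "?v = 0\<^sub>v m"
      using lin_depI[OF Ac v] S us colsA by auto
    then have "col (B * A) j $ i = unit_vec m j $ i" if "i < m" for i
      using that j Bc by (metis eq_iff_diff_eq_0 index_minus_vec(1) index_unit_vec(3) index_zero_vec(1))
    then show "col (B * A) j = col (1\<^sub>m m) j"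
      using Bc j by (intro eq_vecI) auto
  qed (use Ac Bc in auto)
  have "(\<Sum>i<n. P $$ (i, i)) = (\<Sum>i<n. \<Sum>k<m. A $$ (i, k) * B $$ (k, i))"
    unfolding AB using Ac Bc by (simp add: scalar_prod_def atLeast0LessThan)
  also have "\<dots> = (\<Sum>k<m. \<Sum>i<n. A $$ (i, k) * B $$ (k, i))"
    by (rule sum.swap)
  also have "\<dots> = (\<Sum>k<m. (B * A) $$ (k, k))"
    using Ac Bc by (simp add: scalar_prod_def atLeast0LessThan mult_ac)
  also have "\<dots> = real m"
    by (simp add: BA)
  finally show ?thesis .
qed

text \<open>Witnessed by the projection onto the first \<open>m\<close> coordinates, whose rank is
  read off from its trace. The infimum in the Kolmogorov width is thus over a nonempty set.\<close>

lemma orth_projections_nonempty: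
  assumes "m \<le> n"
  shows "orth_projections n m \<noteq> {}"
proof -
  let ?P = "mat_diag n (\<lambda>i. if i < m then 1 else 0 :: real)"
  have "transpose_mat ?P = ?P"
    by (rule eq_matI) (auto simp: mat_diag_def)
  moreover have "?P * ?P = ?P"
    by (simp add: if_distrib cong: if_cong)
  ultimately have P: "?P \<in> orth_projections n (vec_space.rank n ?P)"
    by (simp add: orth_projections_def)
  have "{..<n} \<inter> {i. i < m} = {..<m}"
    using assms by auto
  then have "(\<Sum>i<n. ?P $$ (i, i)) = real m"
    by (simp add: mat_diag_def sum.If_cases)
  then have "vec_space.rank n ?P = m"
    using trace_orth_projection[OF P] by simp
  then show ?thesis
    using P by auto
qed

text \<open>Symmetry and idempotence give \<open><Pv, Pv> = <v, Pv>\<close>; both claims follow by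
  expanding.\<close>

lemma orth_projection_residual:
  assumes P: "P \<in> orth_projections n m" and v: "v \<in> carrier_vec n"
  shows "quad (1\<^sub>m n - P) v = (vnorm (v - P *\<^sub>v v))\<^sup>2"
    and "quad (1\<^sub>m n - P) v \<le> v \<bullet> v"
proof -
  from P have Pc: "P \<in> carrier_mat n n" and sym: "transpose_mat P = P" and idem: "P * P = P"
    by (auto simp: orth_projections_def)
  let ?w = "P *\<^sub>v v"
  have w: "?w \<in> carrier_vec n"
    using Pc v by simp
  have "?w \<bullet> ?w = v \<bullet> (P *\<^sub>v ?w)"
    using transpose_vec_mult_scalar[OF Pc w v] sym w v by (simp add: comm_scalar_prod[of _ n])
  also have "P *\<^sub>v ?w = ?w"
    using assoc_mult_mat_vec[OF Pc Pc v] idem by simp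
  finally have ww: "?w \<bullet> ?w = v \<bullet> ?w" .
  have q: "quad (1\<^sub>m n - P) v = v \<bullet> v - v \<bullet> ?w"
    using v w Pc by (simp add: quad_def minus_mult_distrib_mat_vec[where nr = n and nc = n]
        scalar_prod_minus_distrib[where n = n])
  have "(v - ?w) \<bullet> (v - ?w) = v \<bullet> v - v \<bullet> ?w - (?w \<bullet> v - ?w \<bullet> ?w)"
    using v w by (simp add: scalar_prod_minus_distrib[where n = n] minus_scalar_prod_distrib[where n = n])
  then show "quad (1\<^sub>m n - P) v = (vnorm (v - ?w))\<^sup>2"
    using q ww comm_scalar_prod[OF v w] by (simp add: vnorm_power2)
  show "quad (1\<^sub>m n - P) v \<le> v \<bullet> v"
    using q ww scalar_prod_self_nonneg[of ?w] by simp
qed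

text \<open>For a symmetric idempotent matrix the squared Frobenius norm equals the trace. This norm
  controls the initial distance in the descent argument.\<close>

lemma one_minus_orth_projection_in_fantope:
  assumes P: "P \<in> orth_projections n m"
  shows "1\<^sub>m n - P \<in> fantope n m"
    and "mat_inner n (1\<^sub>m n - P) (1\<^sub>m n - P) = real n - real m"
proof -
  from P have Pc: "P \<in> carrier_mat n n" and sym: "transpose_mat P = P" and idem: "P * P = P"
    by (auto simp: orth_projections_def)
  have tr: "(\<Sum>i<n. P $$ (i, i)) = real m"
    by (rule trace_orth_projection[OF P])
  have Psym: "P $$ (i, j) = P $$ (j, i)" if "i < n" "j < n" for i j
    using arg_cong[OF sym, of "\<lambda>A. A $$ (i, j)"] that Pc by simp
  have "transpose_mat (1\<^sub>m n - P) = 1\<^sub>m n - P"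
    by (rule eq_matI) (use Pc Psym in auto)
  moreover have "(\<Sum>i<n. (1\<^sub>m n - P) $$ (i, i)) = real n - real m"
    using Pc by (simp add: sum_subtractf tr)
  ultimately show "1\<^sub>m n - P \<in> fantope n m"
    using Pc orth_projection_residual[OF P] by (auto simp: fantope_def minus_carrier_mat)
  have PP: "mat_inner n P P = (\<Sum>i<n. (P * P) $$ (i, i))"
    unfolding mat_inner_double_sum
    using Pc Psym by (intro sum.cong) (auto simp: scalar_prod_def atLeast0LessThan intro!: sum.cong)
  have "mat_inner n (1\<^sub>m n - P) (1\<^sub>m n - P)
      = mat_inner n (1\<^sub>m n) (1\<^sub>m n) - 2 * mat_inner n P (1\<^sub>m n) + mat_inner n P P"
  proof -
    have "mat_inner n (1\<^sub>m n - P) (1\<^sub>m n - P)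
      = (\<Sum>x\<in>{..<n} \<times> {..<n}. 1\<^sub>m n $$ x * 1\<^sub>m n $$ x - 2 * (P $$ x * 1\<^sub>m n $$ x) + P $$ x * P $$ x)"
      unfolding mat_inner_def using Pc by (intro sum.cong) (auto simp: algebra_simps)
    then show ?thesis
      by (simp add: mat_inner_def sum.distrib sum_subtractf sum_distrib_left)
  qed
  then show "mat_inner n (1\<^sub>m n - P) (1\<^sub>m n - P) = real n - real m"
    unfolding mat_inner_one PP idem by (simp add: tr)
qed

lemma euclid_ballD:
  assumes "p \<in> euclid_ball n R"
  shows "p \<in> carrier_vec n" "p \<bullet> p \<le> R\<^sup>2"
proof -
  show "p \<in> carrier_vec n"
    using assms by (simp add: euclid_ball_def)
  have "(vnorm p)\<^sup>2 \<le> R\<^sup>2"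
    using assms by (intro power_mono) (auto simp: euclid_ball_def)
  then show "p \<bullet> p \<le> R\<^sup>2"
    by (simp add: vnorm_power2)
qed

text \<open>Strictness yields a projection \<open>P\<close> below \<open>b\<close> even if the
  infimum is not attained; \<open>I - P\<close> is the comparison matrix for the descent.\<close>

lemma near_optimal_fantope:
  assumes m: "m \<le> n" and K: "K \<subseteq> euclid_ball n R" and width: "kolmogorov_width n m K < b"
  obtains W where "W \<in> fantope n m" "mat_inner n W W = real n - real m"
    "\<And>p. p \<in> K \<Longrightarrow> quad W p \<le> b\<^sup>2"
proof -
  have "(\<lambda>P. SUP \<theta>\<in>K. vnorm (\<theta> - P *\<^sub>v \<theta>)) ` orth_projections n m \<noteq> {}"
    using orth_projections_nonempty[OF m] by simp
  from cInf_lessD[OF this width[unfolded kolmogorov_width_def]]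
  obtain P where P: "P \<in> orth_projections n m" and sup: "(SUP \<theta>\<in>K. vnorm (\<theta> - P *\<^sub>v \<theta>)) < b"
    by auto
  \<comment> \<open>A real supremum controls single points only for a bounded set; here
    \<open>|p - P p| \<le> |p|\<close> provides the bound. The sign of \<open>R\<close> is open at
    this stage, hence the absolute value.\<close>
  have bdd: "bdd_above ((\<lambda>\<theta>. vnorm (\<theta> - P *\<^sub>v \<theta>)) ` K)"
  proof (rule bdd_aboveI2)
    fix p assume "p \<in> K"
    then have p: "p \<in> carrier_vec n" "p \<bullet> p \<le> R\<^sup>2"
      using K euclid_ballD by blast+
    have "(vnorm (p - P *\<^sub>v p))\<^sup>2 \<le> \<bar>R\<bar>\<^sup>2"
      using orth_projection_residual[OF P p(1)] p(2) by simp
    then show "vnorm (p - P *\<^sub>v p) \<le> \<bar>R\<bar>"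
      by (rule power2_le_imp_le) simp
  qed
  show thesis
  proof (rule that[OF one_minus_orth_projection_in_fantope[OF P]])
    fix p assume p: "p \<in> K"
    then have "vnorm (p - P *\<^sub>v p) \<le> b"
      using cSUP_upper[OF p bdd] sup by simp
    moreover have "p \<in> carrier_vec n"
      using p K euclid_ballD by blast
    ultimately show "quad (1\<^sub>m n - P) p \<le> b\<^sup>2"
      by (simp add: orth_projection_residual(1)[OF P] power_mono)
  qed
qed

section \<open>Convergence of the iteration\<close>

text \<open>Each result lies in the fantope and so is a test matrix for the other's variational
  inequality. Equal inputs give uniqueness of the step, distinct inputs its continuity.\<close>

lemma sdp_step_nonexpansive:
  assumes "X1 \<in> carrier_mat n n" "sdp_step n m \<kappa> C X1 p1 X1'"
    and "X2 \<in> carrier_mat n n" "sdp_step n m \<kappa> C X2 p2 X2'"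
  shows "(\<Sum>x\<in>{..<n} \<times> {..<n}. (X1' $$ x - X2' $$ x)\<^sup>2)
    \<le> (\<Sum>x\<in>{..<n} \<times> {..<n}. ((X1 $$ x - sdp_stepsize \<kappa> C p1 * outer n p1 $$ x) -
          (X2 $$ x - sdp_stepsize \<kappa> C p2 * outer n p2 $$ x))\<^sup>2)"
  by (rule projection_nonexpansive)
    (rule sdp_step_projection(2)[OF assms(1,2) sdp_step_projection(1)[OF assms(3,4)]],
     rule sdp_step_projection(2)[OF assms(3,4) sdp_step_projection(1)[OF assms(1,2)]])

lemma quad_smult_one:
  assumes "v \<in> carrier_vec n"
  shows "quad (a \<cdot>\<^sub>m 1\<^sub>m n) v = a * (v \<bullet> v)"
proof -
  have "quad (a \<cdot>\<^sub>m 1\<^sub>m n) v = mat_inner n (a \<cdot>\<^sub>m 1\<^sub>m n) (outer n v)"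
    using assms by (intro quad_eq_mat_inner) auto
  also have "\<dots> = a * mat_inner n (outer n v) (1\<^sub>m n)"
    unfolding mat_inner_def sum_distrib_left by (rule sum.cong) (auto simp: algebra_simps)
  also have "mat_inner n (outer n v) (1\<^sub>m n) = v \<bullet> v"
    unfolding mat_inner_one by (simp add: outer_def scalar_prod_sum[OF assms])
  finally show ?thesis .
qed

lemma init_in_fantope:
  assumes "n \<ge> 1" "m \<le> n"
  shows "((real n - real m) / real n) \<cdot>\<^sub>m 1\<^sub>m n \<in> fantope n m"
proof -
  have a: "0 \<le> (real n - real m) / real n" "(real n - real m) / real n \<le> 1"
    using assms by (auto simp: field_simps)
  have "transpose_mat (1\<^sub>m n :: real mat) = 1\<^sub>m n"
    by simp
  then have "transpose_mat (((real n - real m) / real n) \<cdot>\<^sub>m 1\<^sub>m n) = ((real n - real m) / real n) \<cdot>\<^sub>m 1\<^sub>m n"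
    by (intro eq_matI) auto
  moreover have "0 \<le> quad (((real n - real m) / real n) \<cdot>\<^sub>m 1\<^sub>m n) v \<and>
      quad (((real n - real m) / real n) \<cdot>\<^sub>m 1\<^sub>m n) v \<le> v \<bullet> v" if "v \<in> carrier_vec n" for v
    unfolding quad_smult_one[OF that] using a scalar_prod_self_nonneg[of v]
    by (intro conjI mult_nonneg_nonneg mult_left_le_one_le)
  ultimately show ?thesis
    using assms by (simp add: fantope_def)
qed

lemma sdp_run_fantope:
  assumes run: "sdp_run n m \<kappa> C orc X" and "n \<ge> 1" "m < n"
    and "1 \<le> k" "k \<le> Suc (sdp_iterations n m \<kappa> C)"
  shows "X k \<in> fantope n m"
  using assms(4,5)
proof (induction k rule: dec_induct)
  case base
  then show ?case
    using run init_in_fantope[of n m] assms by (simp add: sdp_run_def)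
next
  case (step k)
  then have "sdp_step n m \<kappa> C (X k) (orc k (X k)) (X (Suc k))"
    using run \<open>m < n\<close> by (auto simp: sdp_run_def)
  then show ?case
    using step sdp_step_projection(1) fantope_carrier by (metis Suc_leD)
qed

text \<open>Causality: by nonexpansiveness equal inputs give iterates at distance zero, whatever
  eigendecompositions were chosen. Hence the k-th draw can be resampled without moving the k-th
  iterate.\<close>

lemma sdp_run_cong:
  assumes "sdp_run n m \<kappa> C orc X" "sdp_run n m \<kappa> C orc' X'" and nm: "n \<ge> 1" "m < n"
    and "1 \<le> k" "k \<le> Suc (sdp_iterations n m \<kappa> C)"
    and "\<And>j. 1 \<le> j \<Longrightarrow> j < k \<Longrightarrow> orc j = orc' j"
  shows "X k = X' k"
  using assms(5-7)
proof (induction k rule: dec_induct)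
  case base
  then show ?case
    using assms by (simp add: sdp_run_def)
next
  case (step k)
  then have eq: "X k = X' k" "orc k = orc' k"
    by auto
  have k: "1 \<le> k" "k \<le> sdp_iterations n m \<kappa> C"
    using step by auto
  have steps: "sdp_step n m \<kappa> C (X k) (orc k (X k)) (X (Suc k))"
    "sdp_step n m \<kappa> C (X k) (orc k (X k)) (X' (Suc k))"
    unfolding sdp_run_def using k assms(1,2) \<open>m < n\<close> eq
    by (metis atLeastAtMost_iff less_irrefl sdp_run_def)+
  have f: "X k \<in> fantope n m" "X (Suc k) \<in> fantope n m" "X' (Suc k) \<in> fantope n m"
    using k sdp_run_fantope[OF assms(1) nm] sdp_run_fantope[OF assms(2) nm] by auto
  note c = f[THEN fantope_carrier]
  have "(\<Sum>x\<in>{..<n} \<times> {..<n}. (X (Suc k) $$ x - X' (Suc k) $$ x)\<^sup>2) \<le> 0"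
    using sdp_step_nonexpansive[OF c(1) steps(1) c(1) steps(2)] by simp
  then have "(\<Sum>x\<in>{..<n} \<times> {..<n}. (X (Suc k) $$ x - X' (Suc k) $$ x)\<^sup>2) = 0"
    by (intro antisym sum_nonneg) auto
  then have "\<forall>x\<in>{..<n} \<times> {..<n}. X (Suc k) $$ x = X' (Suc k) $$ x"
    by (subst (asm) sum_nonneg_eq_0_iff) auto
  then show ?case
    using c(2,3) by (intro eq_matI) auto
qed

text \<open>Each step projects, which only decreases the distance to \<open>W\<close>; expanding the
  square before projection leaves the linear gain \<open>f k\<close> and a quadratic error, and the
  sum telescopes.\<close>

lemma sdp_descent:
  assumes run: "sdp_run n m \<kappa> C orc X" and nm: "n \<ge> 1" "m < n"
    and W: "W \<in> fantope n m"
    and p: "\<And>k. k \<in> {1..sdp_iterations n m \<kappa> C} \<Longrightarrow>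
      orc k (X k) \<in> carrier_vec n \<and> 0 < vnorm (orc k (X k))"
  shows "2 * (\<Sum>k = 1..sdp_iterations n m \<kappa> C. sdp_stepsize \<kappa> C (orc k (X k)) *
      (quad (X k) (orc k (X k)) - quad W (orc k (X k))))
    \<le> (\<Sum>x\<in>{..<n} \<times> {..<n}. (X 1 $$ x - W $$ x)\<^sup>2) + real (sdp_iterations n m \<kappa> C) * (sdp_gamma \<kappa> C)\<^sup>2"
proof -
  define D where "D k = (\<Sum>x\<in>{..<n} \<times> {..<n}. (X k $$ x - W $$ x)\<^sup>2)" for k
  define f where "f k = sdp_stepsize \<kappa> C (orc k (X k)) *
      (quad (X k) (orc k (X k)) - quad W (orc k (X k)))" for k
  have step: "D (Suc k) \<le> D k - 2 * f k + (sdp_gamma \<kappa> C)\<^sup>2"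
    if k: "k \<in> {1..sdp_iterations n m \<kappa> C}" for k
  proof -
    define g where "g = sdp_stepsize \<kappa> C (orc k (X k))"
    define q where "q = orc k (X k)"
    have q: "q \<in> carrier_vec n" "0 < vnorm q"
      using p[OF k] by (auto simp: q_def)
    have Xc: "X k \<in> carrier_mat n n"
      using sdp_run_fantope[OF run nm, of k] k by (auto dest: fantope_carrier)
    have st: "sdp_step n m \<kappa> C (X k) q (X (Suc k))"
      using run k nm by (auto simp: sdp_run_def q_def)
    have "D (Suc k) \<le> (\<Sum>x\<in>{..<n} \<times> {..<n}. (X k $$ x - g * outer n q $$ x - W $$ x)\<^sup>2)"
      unfolding D_def
      by (rule projection_closer) (use sdp_step_projection(2)[OF Xc st W] in \<open>simp add: g_def q_def\<close>)
    also have "\<dots> = (\<Sum>x\<in>{..<n} \<times> {..<n}. (X k $$ x - W $$ x)\<^sup>2 -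
        2 * g * (X k $$ x * outer n q $$ x - W $$ x * outer n q $$ x) +
        g\<^sup>2 * (outer n q $$ x * outer n q $$ x))"
      by (rule sum.cong) (simp_all add: power2_eq_square algebra_simps)
    also have "\<dots> = D k - 2 * g * (mat_inner n (X k) (outer n q) - mat_inner n W (outer n q))
        + g\<^sup>2 * mat_inner n (outer n q) (outer n q)"
      by (simp add: D_def mat_inner_def sum.distrib sum_subtractf flip: sum_distrib_left)
    \<comment> \<open>The Frobenius norm of \<open>q q^T\<close> is \<open>|q|^2\<close>, exactly
      what the step size divides by, so the error is the same in every step.\<close>
    also have "g\<^sup>2 * mat_inner n (outer n q) (outer n q) = (sdp_gamma \<kappa> C)\<^sup>2"
      using q by (simp add: mat_inner_outer_self g_def q_def[symmetric] sdp_stepsize_def power_divide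
          flip: power_mult)
    finally show ?thesis
      by (simp add: f_def g_def q_def[symmetric] quad_eq_mat_inner[OF Xc q(1)]
          quad_eq_mat_inner[OF fantope_carrier[OF W] q(1)])
  qed
  have "D (Suc j) + 2 * (\<Sum>k = 1..j. f k) \<le> D 1 + real j * (sdp_gamma \<kappa> C)\<^sup>2"
    if "j \<le> sdp_iterations n m \<kappa> C" for j
    using that
  proof (induction j)
    case (Suc j)
    then show ?case
      using step[of "Suc j"] by (simp add: algebra_simps)
  qed simp
  from this[of "sdp_iterations n m \<kappa> C"] have "D (Suc (sdp_iterations n m \<kappa> C)) +
      2 * (\<Sum>k = 1..sdp_iterations n m \<kappa> C. f k)
    \<le> D 1 + real (sdp_iterations n m \<kappa> C) * (sdp_gamma \<kappa> C)\<^sup>2"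
    by simp
  moreover have "0 \<le> D k" for k
    by (simp add: D_def sum_nonneg)
  ultimately show ?thesis
    unfolding f_def[symmetric] D_def[symmetric] by (smt (verit))
qed

text \<open>With \<open>a = (n - m) / n\<close> the squared distance equals
  \<open>(n - m) * (1 - a)\<close>.\<close>

lemma init_distance:
  assumes "n \<ge> 1" "m \<le> n" and W: "W \<in> fantope n m" and WW: "mat_inner n W W = real n - real m"
    and X: "X = ((real n - real m) / real n) \<cdot>\<^sub>m 1\<^sub>m n"
  shows "(\<Sum>x\<in>{..<n} \<times> {..<n}. (X $$ x - W $$ x)\<^sup>2) \<le> real n - real m"
proof -
  define a where "a = (real n - real m) / real n"
  have an: "a * real n = real n - real m"
    using assms by (simp add: a_def)
  have a0: "0 \<le> a"
    using assms by (simp add: a_def)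
  have "(\<Sum>x\<in>{..<n} \<times> {..<n}. (X $$ x - W $$ x)\<^sup>2)
      = (\<Sum>x\<in>{..<n} \<times> {..<n}. a\<^sup>2 * (1\<^sub>m n $$ x * 1\<^sub>m n $$ x) - 2 * a * (W $$ x * 1\<^sub>m n $$ x) + W $$ x * W $$ x)"
    unfolding X a_def[symmetric]
    by (intro sum.cong refl) (auto simp: power2_eq_square algebra_simps)
  also have "\<dots> = a\<^sup>2 * mat_inner n (1\<^sub>m n) (1\<^sub>m n) - 2 * a * mat_inner n W (1\<^sub>m n) + mat_inner n W W"
    by (simp add: mat_inner_def sum.distrib sum_subtractf sum_distrib_left)
  also have "\<dots> = a * (a * real n) - 2 * a * (real n - real m) + (real n - real m)"
    using W WW by (simp add: mat_inner_one fantope_def power2_eq_square)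
  also have "\<dots> \<le> real n - real m"
    unfolding an using mult_nonneg_nonneg[OF a0, of "real n - real m"] assms(2) by simp
  finally show ?thesis .
qed

lemma quad_scaled_unit_vec:
  assumes X: "X \<in> carrier_mat n n" and "i < n"
  shows "quad X (r \<cdot>\<^sub>v unit_vec n i) = r\<^sup>2 * X $$ (i, i)"
proof -
  have "X *\<^sub>v (r \<cdot>\<^sub>v unit_vec n i) = r \<cdot>\<^sub>v col X i"
    using assms by (intro eq_vecI) (auto simp: scalar_prod_right_unit)
  then show ?thesis
    using assms by (simp add: quad_def power2_eq_square)
qed

lemma vnorm_scaled_unit_vec: "i < n \<Longrightarrow> 0 \<le> r \<Longrightarrow> vnorm (r \<cdot>\<^sub>v unit_vec n i) = r"
  by (simp add: vnorm_def)

lemma quad_sdp_output: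
  assumes "m \<noteq> n" "\<And>k. 1 \<le> k \<Longrightarrow> k \<le> sdp_iterations n m \<kappa> C \<Longrightarrow> X k \<in> carrier_mat n n"
    and p: "p \<in> carrier_vec n"
  shows "quad (sdp_output n m \<kappa> C orc X) p
    = (\<Sum>k = 1..sdp_iterations n m \<kappa> C. sdp_stepsize \<kappa> C (orc k (X k)) * quad (X k) p)
      / (\<Sum>k = 1..sdp_iterations n m \<kappa> C. sdp_stepsize \<kappa> C (orc k (X k)))"
proof -
  let ?N = "sdp_iterations n m \<kappa> C" and ?X = "sdp_output n m \<kappa> C orc X"
  let ?g = "\<lambda>k. sdp_stepsize \<kappa> C (orc k (X k))"
  have c: "?X \<in> carrier_mat n n"
    using assms(1) by (simp add: sdp_output_def Let_def)
  have "quad ?X p = (\<Sum>x\<in>{..<n} \<times> {..<n}. \<Sum>k = 1..?N. ?g k * (X k $$ x * outer n p $$ x)) / (\<Sum>k = 1..?N. ?g k)"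
    unfolding quad_eq_mat_inner[OF c p] mat_inner_def sum_divide_distrib
    using assms(1)
    by (intro sum.cong) (auto simp: sdp_output_def Let_def sum_distrib_right sum_distrib_left sum_divide_distrib mult_ac intro!: sum.cong)
  also have "(\<Sum>x\<in>{..<n} \<times> {..<n}. \<Sum>k = 1..?N. ?g k * (X k $$ x * outer n p $$ x))
      = (\<Sum>k = 1..?N. \<Sum>x\<in>{..<n} \<times> {..<n}. ?g k * (X k $$ x * outer n p $$ x))"
    by (rule sum.swap)
  also have "\<dots> = (\<Sum>k = 1..?N. ?g k * quad (X k) p)"
    using p by (intro sum.cong refl)
      (simp add: quad_eq_mat_inner[OF assms(2)] mat_inner_def sum_distrib_left)
  finally show ?thesis .
qed

text \<open>The deterministic part. An accurate answer dominates all of \<open>K\<close> up to the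
  factor \<open>\<kappa>\<close>, so the average of \<open>quad (X k) p\<close> is at most
  \<open>\<kappa>\<close> times the average of the observed values, which the descent compares with
  \<open>W\<close>.\<close>

lemma sdp_output_bound:
  assumes run: "sdp_run n m \<kappa> C orc X" and nm: "n \<ge> 1" "m < n" and \<kappa>: "\<kappa> \<ge> 1" and C: "C > 0"
    and r: "r > 0" "euclid_ball n r \<subseteq> K" and K: "K \<subseteq> euclid_ball n R" and R: "R > 0"
    and orcK: "\<And>k. k \<in> {1..sdp_iterations n m \<kappa> C} \<Longrightarrow> orc k (X k) \<in> K"
    and good: "\<And>k. k \<in> {1..sdp_iterations n m \<kappa> C} \<Longrightarrow>
      inverse \<kappa> * (SUP p\<in>K. quad (X k) p) \<le> quad (X k) (orc k (X k))"
    and W: "W \<in> fantope n m" "mat_inner n W W = real n - real m"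
    and w: "\<And>p. p \<in> K \<Longrightarrow> quad W p \<le> w"
  shows "(SUP p\<in>K. quad (sdp_output n m \<kappa> C orc X) p) \<le> R\<^sup>2 / C\<^sup>2 + \<kappa> * w"
proof -
  define N where "N = sdp_iterations n m \<kappa> C"
  define \<gamma> where "\<gamma> = sdp_gamma \<kappa> C"
  define P where "P k = orc k (X k)" for k
  define g where "g k = sdp_stepsize \<kappa> C (P k)" for k
  define \<Gamma> where "\<Gamma> = (\<Sum>k = 1..N. g k)"
  have \<gamma>: "\<gamma> > 0"
    using \<kappa> C by (simp add: \<gamma>_def sdp_gamma_def)
  have N1: "1 \<le> N"
    by (simp add: N_def sdp_iterations_def)
  have X: "X k \<in> fantope n m" if "k \<in> {1..N}" for k
    using sdp_run_fantope[OF run nm] that by (auto simp: N_def)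
  have PK: "P k \<in> K" if "k \<in> {1..N}" for k
    using orcK that by (simp add: P_def N_def)
  have Kc: "p \<in> carrier_vec n" "p \<bullet> p \<le> R\<^sup>2" if "p \<in> K" for p
    using that K euclid_ballD by blast+
  have quad_le: "quad (X k) p \<le> p \<bullet> p" if "k \<in> {1..N}" "p \<in> K" for k p
    using X[OF that(1)] Kc[OF that(2)] by (simp add: fantope_def)
  have bdd: "bdd_above (quad (X k) ` K)" if "k \<in> {1..N}" for k
    using quad_le[OF that] Kc by (intro bdd_aboveI2[of _ _ "R\<^sup>2"]) (meson order_trans)
  have sup: "quad (X k) p \<le> \<kappa> * quad (X k) (P k)" if k: "k \<in> {1..N}" and p: "p \<in> K" for k p
  proof -
    have "quad (X k) p \<le> \<kappa> * (inverse \<kappa> * (SUP p\<in>K. quad (X k) p))"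
      using cSUP_upper[OF p bdd[OF k]] \<kappa> by (simp flip: mult.assoc)
    also have "\<dots> \<le> \<kappa> * quad (X k) (P k)"
      using good[of k] k \<kappa> by (intro mult_left_mono) (auto simp: N_def P_def)
    finally show ?thesis .
  qed
  \<comment> \<open>A zero answer would make the quadratic form of \<open>X k\<close> vanish on a ball, although its trace
    \<open>n - m\<close> is positive. So the junk step size \<open>\<gamma> / 0 = 0\<close> does not occur.\<close>
  have Ppos: "0 < vnorm (P k)" if k: "k \<in> {1..N}" for k
  proof (rule ccontr)
    assume "\<not> 0 < vnorm (P k)"
    then have "vnorm (P k) = 0"
      using vnorm_nonneg[of "P k"] by linarith
    then have "P k \<bullet> P k = 0"
      using vnorm_power2[of "P k"] by simp
    then have le: "quad (X k) (P k) \<le> 0"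
      using quad_le[OF k PK[OF k]] by simp
    have "X k $$ (i, i) \<le> 0" if i: "i < n" for i
    proof -
      have "r \<cdot>\<^sub>v unit_vec n i \<in> K"
        using r i by (auto simp: euclid_ball_def vnorm_scaled_unit_vec intro!: subsetD[OF r(2)])
      then have "r\<^sup>2 * X k $$ (i, i) \<le> \<kappa> * quad (X k) (P k)"
        using sup[OF k, of "r \<cdot>\<^sub>v unit_vec n i"] quad_scaled_unit_vec[OF fantope_carrier[OF X[OF k]] i, of r] by simp
      also have "\<dots> \<le> 0"
        using le \<kappa> by (simp add: mult_nonneg_nonpos)
      finally show ?thesis
        using r by (simp add: mult_le_0_iff)
    qed
    then have "(\<Sum>i<n. X k $$ (i, i)) \<le> 0"
      by (intro sum_nonpos) auto
    then show False
      using X[OF k] nm by (simp add: fantope_def)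
  qed
  \<comment> \<open>Answers lie in the ball of radius \<open>R\<close>, so no weight is too small;
    here \<open>R^2\<close> enters the final bound.\<close>
  have glb: "\<gamma> / R\<^sup>2 \<le> g k" if k: "k \<in> {1..N}" for k
  proof -
    have "(vnorm (P k))\<^sup>2 \<le> R\<^sup>2"
      using Kc(2)[OF PK[OF k]] by (simp add: vnorm_power2)
    then show ?thesis
      using Ppos[OF k] \<gamma> R unfolding g_def sdp_stepsize_def \<gamma>_def[symmetric]
      by (intro divide_left_mono mult_pos_pos) auto
  qed
  have g0: "0 \<le> g k" if "k \<in> {1..N}" for k
    using glb[OF that] \<gamma> R by (meson divide_nonneg_pos less_imp_le order_trans zero_less_power)
  have \<Gamma>lb: "real N * (\<gamma> / R\<^sup>2) \<le> \<Gamma>"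
    unfolding \<Gamma>_def using sum_mono[of "{1..N}" "\<lambda>_. \<gamma> / R\<^sup>2" g] glb by simp
  have \<Gamma>lb0: "0 < real N * (\<gamma> / R\<^sup>2)"
    using N1 \<gamma> R by simp
  then have \<Gamma>: "0 < \<Gamma>"
    using \<Gamma>lb by simp
  have "2 * (\<Sum>k = 1..N. g k * (quad (X k) (P k) - quad W (P k)))
      \<le> (\<Sum>x\<in>{..<n} \<times> {..<n}. (X 1 $$ x - W $$ x)\<^sup>2) + real N * \<gamma>\<^sup>2"
    unfolding g_def N_def P_def \<gamma>_def
    by (rule sdp_descent[OF run nm W(1)]) (use PK Kc Ppos in \<open>auto simp: P_def N_def\<close>)
  also have "(\<Sum>x\<in>{..<n} \<times> {..<n}. (X 1 $$ x - W $$ x)\<^sup>2) \<le> real n - real m"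
    using run nm W by (intro init_distance) (auto simp: sdp_run_def)
  finally have "2 * (\<Sum>k = 1..N. g k * quad (X k) (P k))
      \<le> real n - real m + real N * \<gamma>\<^sup>2 + 2 * (\<Sum>k = 1..N. g k * quad W (P k))"
    by (simp add: algebra_simps sum_subtractf)
  also have "(\<Sum>k = 1..N. g k * quad W (P k)) \<le> (\<Sum>k = 1..N. g k * w)"
    using PK w g0 by (intro sum_mono mult_left_mono) auto
  also have "(\<Sum>k = 1..N. g k * w) = \<Gamma> * w"
    by (simp add: \<Gamma>_def sum_distrib_right)
  finally have main: "(\<Sum>k = 1..N. g k * quad (X k) (P k)) \<le> (real n - real m + real N * \<gamma>\<^sup>2) / 2 + \<Gamma> * w"
    by (simp add: field_simps)
  \<comment> \<open>The parameters balance the two errors: the choice of \<open>\<gamma>\<close>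
    turns the step error into \<open>R^2 / (2 C^2)\<close>, and the number of iterations makes the
    initial-distance term at most \<open>R^2 / (8 C^2)\<close>.\<close>
  have numeric: "\<kappa> * ((real n - real m + real N * \<gamma>\<^sup>2) / 2) / \<Gamma> \<le> R\<^sup>2 / C\<^sup>2"
  proof -
    have "4 * (real n - real m) * C ^ 4 * \<kappa>\<^sup>2 \<le> real N"
      unfolding N_def sdp_iterations_def by linarith
    then have "\<kappa>\<^sup>2 * C\<^sup>2 * (real n - real m) \<le> real N / (4 * C\<^sup>2)"
      using C by (simp add: field_simps power2_eq_square power4_eq_xxxx)
    then have 1: "\<kappa>\<^sup>2 * C\<^sup>2 * (real n - real m) / (2 * real N) \<le> 1 / (8 * C\<^sup>2)"
      using N1 C by (simp add: field_simps)
    have "\<kappa> * ((real n - real m + real N * \<gamma>\<^sup>2) / 2) / \<Gamma>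
        \<le> \<kappa> * ((real n - real m + real N * \<gamma>\<^sup>2) / 2) / (real N * (\<gamma> / R\<^sup>2))"
      using \<kappa> nm by (intro divide_left_mono[OF \<Gamma>lb _ mult_pos_pos[OF \<Gamma> \<Gamma>lb0]]) auto
    also have "\<dots> = R\<^sup>2 * (\<kappa> / \<gamma> * (real n - real m) / (2 * real N) + \<kappa> * \<gamma> / 2)"
      using N1 \<gamma> R by (simp add: field_simps power2_eq_square)
    also have "\<kappa> / \<gamma> = \<kappa>\<^sup>2 * C\<^sup>2"
      by (simp add: \<gamma>_def sdp_gamma_def power2_eq_square)
    also have "\<kappa> * \<gamma> / 2 = 1 / (2 * C\<^sup>2)"
      using \<kappa> by (simp add: \<gamma>_def sdp_gamma_def)
    also have "R\<^sup>2 * (\<kappa>\<^sup>2 * C\<^sup>2 * (real n - real m) / (2 * real N) + 1 / (2 * C\<^sup>2))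
        \<le> R\<^sup>2 * (1 / (8 * C\<^sup>2) + 1 / (2 * C\<^sup>2))"
      using 1 by (intro mult_left_mono add_right_mono) auto
    also have "\<dots> \<le> R\<^sup>2 * (1 / C\<^sup>2)"
      using C by (intro mult_left_mono) (auto simp: field_simps)
    finally show ?thesis by simp
  qed
  show ?thesis
  proof (rule cSUP_least)
    show "K \<noteq> {}"
      using PK[of 1] N1 by auto
    fix p assume p: "p \<in> K"
    have "quad (sdp_output n m \<kappa> C orc X) p = (\<Sum>k = 1..N. g k * quad (X k) p) / \<Gamma>"
      using X Kc(1)[OF p] nm fantope_carrier
      by (subst quad_sdp_output) (auto simp: N_def \<Gamma>_def g_def P_def)
    also have "\<dots> \<le> (\<Sum>k = 1..N. g k * (\<kappa> * quad (X k) (P k))) / \<Gamma>"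
      using \<Gamma> g0 sup[OF _ p] by (intro divide_right_mono sum_mono mult_left_mono) auto
    also have "\<dots> = \<kappa> * (\<Sum>k = 1..N. g k * quad (X k) (P k)) / \<Gamma>"
      by (simp add: sum_distrib_left mult_ac)
    also have "\<dots> \<le> \<kappa> * ((real n - real m + real N * \<gamma>\<^sup>2) / 2 + \<Gamma> * w) / \<Gamma>"
      using main \<Gamma> \<kappa> by (intro divide_right_mono mult_left_mono) auto
    also have "\<dots> = \<kappa> * ((real n - real m + real N * \<gamma>\<^sup>2) / 2) / \<Gamma> + \<kappa> * w"
      using \<Gamma> by (simp add: field_simps)
    finally show "quad (sdp_output n m \<kappa> C orc X) p \<le> R\<^sup>2 / C\<^sup>2 + \<kappa> * w"
      using numeric by simp
  qed
qed

section \<open>Measurability and independence\<close>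

text \<open>The sigma-algebra is pulled back along the coordinate map, so entries suffice.\<close>

lemma measurable_psd_borelI:
  assumes psd: "\<And>\<omega>. \<omega> \<in> space M \<Longrightarrow> psd_mat n (F \<omega>)"
    and meas: "\<And>x. x \<in> {..<n} \<times> {..<n} \<Longrightarrow> (\<lambda>\<omega>. F \<omega> $$ x) \<in> borel_measurable M"
  shows "F \<in> measurable M (psd_borel n)"
  unfolding psd_borel_def
proof (rule measurable_vimage_algebra2)
  show "(\<lambda>\<omega>. mat_coords n (F \<omega>)) \<in> borel_measurable M"
  proof (rule measurable_coordinatewise_then_product)
    fix x :: "nat \<times> nat"
    have "mat_coords n A x = (if x \<in> {..<n} \<times> {..<n} then A $$ x else 0)" for A
      by (cases x) (simp add: mat_coords_def)
    then show "(\<lambda>\<omega>. mat_coords n (F \<omega>) x) \<in> borel_measurable M"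
      using meas[of x] by (cases "x \<in> {..<n} \<times> {..<n}") simp_all
  qed
qed (use psd in auto)

lemma vec_borel_index_measurable:
  assumes F: "F \<in> measurable M (vec_borel n)" and i: "i < n"
  shows "(\<lambda>\<omega>. F \<omega> $ i) \<in> borel_measurable M"
proof -
  have "vec_coords n \<in> borel_measurable (vec_borel n)"
    unfolding vec_borel_def by (rule measurable_vimage_algebra1) simp
  from measurable_compose[OF F this]
  have "(\<lambda>\<omega>. vec_coords n (F \<omega>) i) \<in> borel_measurable M"
    by (rule measurable_product_then_coordinatewise)
  then show ?thesis
    using i by (simp add: vec_coords_def)
qed

text \<open>The superlevel sets of \<^term>\<open>F\<close> are preimages of unions of balls around the values of
  \<^term>\<open>Y\<close>, so no extension of \<^term>\<open>F\<close> as a function of \<^term>\<open>Y\<close> beyond the range of \<^term>\<open>Y\<close> is needed.\<close>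

lemma borel_measurable_nonexpansive:
  fixes Y :: "'a \<Rightarrow> 'i::countable \<Rightarrow> real" and F :: "'a \<Rightarrow> real"
  assumes meas: "\<And>x. x \<in> I \<Longrightarrow> (\<lambda>\<omega>. Y \<omega> x) \<in> borel_measurable M"
    and le: "\<And>\<omega> \<omega>'. \<omega> \<in> space M \<Longrightarrow> \<omega>' \<in> space M \<Longrightarrow> (F \<omega> - F \<omega>')\<^sup>2 \<le> (\<Sum>x\<in>I. (Y \<omega> x - Y \<omega>' x)\<^sup>2)"
  shows "F \<in> borel_measurable M"
  unfolding borel_measurable_iff_greater
proof
  fix a
  \<comment> \<open>Extension by zero gives a point of the whole product space; its countable index
    type allows measurability to be checked coordinatewise.\<close>
  define y where "y \<omega> = (\<lambda>x. if x \<in> I then Y \<omega> x else 0)" for \<omega>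
  define U where "U = (\<Union>\<omega>'\<in>{\<omega>' \<in> space M. a < F \<omega>'}. {z :: 'i \<Rightarrow> real. (\<Sum>x\<in>I. (z x - Y \<omega>' x)\<^sup>2) < (F \<omega>' - a)\<^sup>2})"
  have y: "y \<in> borel_measurable M"
  proof (rule measurable_coordinatewise_then_product)
    show "(\<lambda>\<omega>. y \<omega> x) \<in> borel_measurable M" for x
      unfolding y_def using meas[of x] by (cases "x \<in> I") simp_all
  qed
  \<comment> \<open>The union may be uncountable, so measurability comes from openness: each
    condition is strict and continuous in the product topology.\<close>
  have "open U"
    unfolding U_def
    by (intro open_UN ballI open_Collect_less continuous_intros continuous_on_product_coordinates)
  then have "U \<in> sets borel"
    by simp
  moreover have "{\<omega> \<in> space M. a < F \<omega>} = y -` U \<inter> space M"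
  proof (rule equalityI; rule subsetI)
    fix \<omega> assume "\<omega> \<in> y -` U \<inter> space M"
    then obtain \<omega>' where \<omega>: "\<omega> \<in> space M" "\<omega>' \<in> space M" "a < F \<omega>'"
      and "(\<Sum>x\<in>I. (y \<omega> x - Y \<omega>' x)\<^sup>2) < (F \<omega>' - a)\<^sup>2"
      by (auto simp: U_def)
    then have "(F \<omega>' - F \<omega>)\<^sup>2 < (F \<omega>' - a)\<^sup>2"
      using le[OF \<omega>(1,2)] by (simp add: y_def power2_commute)
    then have "F \<omega>' - F \<omega> < F \<omega>' - a"
      by (rule power2_less_imp_less) (use \<omega> in simp)
    then show "\<omega> \<in> {\<omega> \<in> space M. a < F \<omega>}"
      using \<omega> by simp
  qed (auto simp: U_def y_def intro!: bexI)
  ultimately show "{\<omega> \<in> space M. a < F \<omega>} \<in> sets M"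
    using measurable_sets[OF y] by simp
qed

lemma outer_index_bound:
  assumes p: "p \<in> euclid_ball n R" and x: "x \<in> {..<n} \<times> {..<n}"
  shows "\<bar>outer n p $$ x\<bar> \<le> R\<^sup>2"
proof -
  note pc = euclid_ballD[OF p]
  obtain i j where x': "x = (i, j)" "i < n" "j < n"
    using x by auto
  have sq: "(p $ k)\<^sup>2 \<le> R\<^sup>2" if "k < n" for k
  proof -
    have "(p $ k)\<^sup>2 \<le> (\<Sum>i<n. (p $ i)\<^sup>2)"
      using that by (intro member_le_sum) auto
    also have "\<dots> = p \<bullet> p"
      by (simp add: scalar_prod_sum[OF pc(1)] power2_eq_square)
    finally show ?thesis using pc(2) by simp
  qed
  have "\<bar>p $ i\<bar> * \<bar>p $ j\<bar> \<le> \<bar>R\<bar> * \<bar>R\<bar>"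
    using sq[OF x'(2)] sq[OF x'(3)] by (intro mult_mono) (auto simp: abs_le_square_iff)
  then show ?thesis
    using x' by (simp add: outer_def abs_mult power2_eq_square)
qed

lemma bdd_above_quad:
  assumes "X \<in> carrier_mat n n" and K: "K \<subseteq> euclid_ball n R"
  shows "bdd_above (quad X ` K)"
proof (rule bdd_aboveI2)
  fix p assume p: "p \<in> K"
  have "quad X p = (\<Sum>x\<in>{..<n} \<times> {..<n}. X $$ x * outer n p $$ x)"
    using p K euclid_ballD(1) assms(1) by (auto simp: quad_eq_mat_inner mat_inner_def)
  also have "\<dots> \<le> (\<Sum>x\<in>{..<n} \<times> {..<n}. \<bar>X $$ x\<bar> * R\<^sup>2)"
  proof (rule sum_mono)
    fix x :: "nat \<times> nat" assume x: "x \<in> {..<n} \<times> {..<n}"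
    have "X $$ x * outer n p $$ x \<le> \<bar>X $$ x\<bar> * \<bar>outer n p $$ x\<bar>"
      by (metis abs_ge_self abs_mult)
    also have "\<dots> \<le> \<bar>X $$ x\<bar> * R\<^sup>2"
      using outer_index_bound[OF _ x, of p R] p K by (intro mult_left_mono) auto
    finally show "X $$ x * outer n p $$ x \<le> \<bar>X $$ x\<bar> * R\<^sup>2" .
  qed
  finally show "quad X p \<le> (\<Sum>x\<in>{..<n} \<times> {..<n}. \<bar>X $$ x\<bar> * R\<^sup>2)" .
qed

text \<open>The supremum may range over uncountably many points, but its sublevel sets are preimages
  of intersections of closed half-spaces, which are closed.\<close>

lemma borel_measurable_SUP_quad:
  assumes K: "K \<subseteq> euclid_ball n R" "K \<noteq> {}"
    and carrier: "\<And>\<omega>. \<omega> \<in> space M \<Longrightarrow> F \<omega> \<in> carrier_mat n n"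
    and meas: "\<And>x. x \<in> {..<n} \<times> {..<n} \<Longrightarrow> (\<lambda>\<omega>. F \<omega> $$ x) \<in> borel_measurable M"
  shows "(\<lambda>\<omega>. SUP p\<in>K. quad (F \<omega>) p) \<in> borel_measurable M"
  unfolding borel_measurable_iff_le
proof
  fix a
  define y where "y \<omega> = (\<lambda>x. if x \<in> {..<n} \<times> {..<n} then F \<omega> $$ x else 0)" for \<omega>
  define V where "V = (\<Inter>p\<in>K. {z. (\<Sum>x\<in>{..<n} \<times> {..<n}. z x * outer n p $$ x) \<le> a})"
  have y: "y \<in> borel_measurable M"
  proof (rule measurable_coordinatewise_then_product)
    show "(\<lambda>\<omega>. y \<omega> x) \<in> borel_measurable M" for x
      unfolding y_def using meas[of x] by (cases "x \<in> {..<n} \<times> {..<n}") simp_all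
  qed
  have "closed V"
    unfolding V_def
    by (intro closed_INT ballI closed_Collect_le continuous_intros continuous_on_product_coordinates)
  then have "V \<in> sets borel"
    by simp
  moreover have "{\<omega> \<in> space M. (SUP p\<in>K. quad (F \<omega>) p) \<le> a} = y -` V \<inter> space M"
  proof -
    have "(SUP p\<in>K. quad (F \<omega>) p) \<le> a \<longleftrightarrow> y \<omega> \<in> V" if \<omega>: "\<omega> \<in> space M" for \<omega>
    proof -
      have "(SUP p\<in>K. quad (F \<omega>) p) \<le> a \<longleftrightarrow> (\<forall>p\<in>K. quad (F \<omega>) p \<le> a)"
        by (rule cSUP_le_iff[OF K(2) bdd_above_quad[OF carrier[OF \<omega>] K(1)]])
      also have "\<dots> \<longleftrightarrow> y \<omega> \<in> V"
      proof -
        have "quad (F \<omega>) p = (\<Sum>x\<in>{..<n} \<times> {..<n}. y \<omega> x * outer n p $$ x)" if "p \<in> K" for p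
          using euclid_ballD(1)[OF subsetD[OF K(1) that]]
          by (simp add: quad_eq_mat_inner[OF carrier[OF \<omega>]] mat_inner_def y_def)
        then show ?thesis
          by (simp add: V_def)
      qed
      finally show ?thesis .
    qed
    then show ?thesis by auto
  qed
  ultimately show "{\<omega> \<in> space M. (SUP p\<in>K. quad (F \<omega>) p) \<le> a} \<in> sets M"
    using measurable_sets[OF y] by simp
qed

lemma borel_measurable_quad:
  assumes carrier: "\<And>\<omega>. \<omega> \<in> space M \<Longrightarrow> F \<omega> \<in> carrier_mat n n" "\<And>\<omega>. \<omega> \<in> space M \<Longrightarrow> p \<omega> \<in> carrier_vec n"
    and meas: "\<And>x. x \<in> {..<n} \<times> {..<n} \<Longrightarrow> (\<lambda>\<omega>. F \<omega> $$ x) \<in> borel_measurable M"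
      "\<And>i. i < n \<Longrightarrow> (\<lambda>\<omega>. p \<omega> $ i) \<in> borel_measurable M"
  shows "(\<lambda>\<omega>. quad (F \<omega>) (p \<omega>)) \<in> borel_measurable M"
proof -
  have "(\<lambda>\<omega>. \<Sum>i<n. \<Sum>j<n. F \<omega> $$ (i, j) * (p \<omega> $ i * p \<omega> $ j)) \<in> borel_measurable M"
    by (intro borel_measurable_sum borel_measurable_times meas) auto
  then show ?thesis
    by (rule measurable_cong[THEN iffD1, rotated])
      (auto simp: quad_eq_mat_inner[OF carrier] mat_inner_double_sum outer_def intro!: sum.cong)
qed

lemma borel_measurable_sdp_stepsize:
  assumes carrier: "\<And>\<omega>. \<omega> \<in> space M \<Longrightarrow> p \<omega> \<in> carrier_vec n"
    and meas: "\<And>i. i < n \<Longrightarrow> (\<lambda>\<omega>. p \<omega> $ i) \<in> borel_measurable M"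
  shows "(\<lambda>\<omega>. sdp_stepsize \<kappa> C (p \<omega>)) \<in> borel_measurable M"
proof -
  have "(\<lambda>\<omega>. sdp_gamma \<kappa> C / (\<Sum>i<n. p \<omega> $ i * p \<omega> $ i)) \<in> borel_measurable M"
    by (intro borel_measurable_divide borel_measurable_sum borel_measurable_times meas) auto
  then show ?thesis
    by (rule measurable_cong[THEN iffD1, rotated])
      (simp add: sdp_stepsize_def vnorm_power2 scalar_prod_sum[OF carrier])
qed

lemma randomized_oracleD:
  assumes "randomized_oracle n K \<kappa> q S"
  shows "prob_space S"
    and "\<And>f X. f \<in> space S \<Longrightarrow> psd_mat n X \<Longrightarrow> f X \<in> K"
    and "\<And>X. psd_mat n X \<Longrightarrow>
      \<P>(f in S. inverse \<kappa> * (SUP p \<in> K. quad X p) \<le> quad X (f X)) \<ge> 1 - q"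
    and "\<And>M f X. f \<in> measurable M S \<Longrightarrow> X \<in> measurable M (psd_borel n) \<Longrightarrow>
      (\<lambda>\<omega>. f \<omega> (X \<omega>)) \<in> measurable M (vec_borel n)"
proof -
  fix M f X assume "f \<in> measurable M S" "X \<in> measurable M (psd_borel n)"
  then have "(\<lambda>\<omega>. (f \<omega>, X \<omega>)) \<in> measurable M (S \<Otimes>\<^sub>M psd_borel n)"
    by (rule measurable_Pair)
  moreover have "(\<lambda>(f, X). f X) \<in> measurable (S \<Otimes>\<^sub>M psd_borel n) (vec_borel n)"
    using assms by (simp add: randomized_oracle_def)
  ultimately show "(\<lambda>\<omega>. f \<omega> (X \<omega>)) \<in> measurable M (vec_borel n)"
    using measurable_compose by fastforce
qed (use assms in \<open>auto simp: randomized_oracle_def\<close>)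

text \<open>Fubini with coordinate \<open>i\<close> innermost: a bound on every slice survives
  averaging over the other coordinates.\<close>

lemma PiM_prob_le_of_component:
  fixes S :: "'b measure"
  assumes S: "prob_space S" and I: "finite I" "i \<in> I"
    and A: "A \<in> sets (\<Pi>\<^sub>M j\<in>I. S)"
    and le: "\<And>x. x \<in> space (\<Pi>\<^sub>M j\<in>I - {i}. S) \<Longrightarrow> measure S {y \<in> space S. x(i := y) \<in> A} \<le> q"
  shows "measure (\<Pi>\<^sub>M j\<in>I. S) A \<le> q"
proof -
  interpret S: prob_space S by (rule S)
  interpret product_prob_space "\<lambda>_. S" "UNIV"
    by unfold_locales
  interpret PI: prob_space "\<Pi>\<^sub>M j\<in>I. S"
    by (intro prob_space_PiM S)
  interpret rest: prob_space "\<Pi>\<^sub>M j\<in>I - {i}. S"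
    by (intro prob_space_PiM S)
  have ins: "insert i (I - {i}) = I"
    using I by auto
  have upd: "(\<lambda>y. x(i := y)) \<in> measurable S (\<Pi>\<^sub>M j\<in>I. S)" if "x \<in> space (\<Pi>\<^sub>M j\<in>I - {i}. S)" for x
    using measurable_component_update[OF that, of i] ins by simp
  \<comment> \<open>\<open>ennreal\<close> sends negative numbers to 0, so returning to the reals at
    the end needs this sign; any single slice provides it.\<close>
  have q: "0 \<le> q"
  proof -
    obtain x where "x \<in> space (\<Pi>\<^sub>M j\<in>I - {i}. S)"
      using rest.not_empty by blast
    from le[OF this] show ?thesis
      using measure_nonneg order_trans by blast
  qed
  have "emeasure (\<Pi>\<^sub>M j\<in>I. S) A = (\<integral>\<^sup>+ \<omega>. indicator A \<omega> \<partial>(\<Pi>\<^sub>M j\<in>I. S))"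
    using A by simp
  also have "\<dots> = (\<integral>\<^sup>+ x. (\<integral>\<^sup>+ y. indicator A (x(i := y)) \<partial>S) \<partial>(\<Pi>\<^sub>M j\<in>I - {i}. S))"
    using product_nn_integral_insert[of "I - {i}" i "indicator A"] I A by (simp add: insert_absorb)
  also have "\<dots> \<le> (\<integral>\<^sup>+ x. ennreal q \<partial>(\<Pi>\<^sub>M j\<in>I - {i}. S))"
  proof (rule nn_integral_mono)
    fix x assume x: "x \<in> space (\<Pi>\<^sub>M j\<in>I - {i}. S)"
    have "(\<lambda>y. x(i := y)) -` A \<inter> space S = {y \<in> space S. x(i := y) \<in> A}"
      by auto
    then have sets: "{y \<in> space S. x(i := y) \<in> A} \<in> sets S"
      using measurable_sets[OF upd[OF x] A] by simp
    have "(\<integral>\<^sup>+ y. indicator A (x(i := y)) \<partial>S) = (\<integral>\<^sup>+ y. indicator {y \<in> space S. x(i := y) \<in> A} y \<partial>S)"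
      by (rule nn_integral_cong) (auto simp: indicator_def)
    also have "\<dots> = ennreal (measure S {y \<in> space S. x(i := y) \<in> A})"
      using sets by (simp add: S.emeasure_eq_measure)
    also have "\<dots> \<le> ennreal q"
      using le[OF x] by (rule ennreal_leI)
    finally show "(\<integral>\<^sup>+ y. indicator A (x(i := y)) \<partial>S) \<le> ennreal q" .
  qed
  also have "\<dots> = ennreal q"
    by (simp add: rest.emeasure_space_1)
  finally show ?thesis
    using q by (simp add: PI.emeasure_eq_measure)
qed

section \<open>The random run of the procedure for \<open>m < n\<close>\<close>

context
  fixes n m :: nat and \<kappa> C q R :: real and K :: "real vec set"
    and S :: "(real mat \<Rightarrow> real vec) measure"
    and X :: "(nat \<Rightarrow> real mat \<Rightarrow> real vec) \<Rightarrow> nat \<Rightarrow> real mat"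
    and N :: nat
  assumes nm: "n \<ge> 1" "m < n"
    and K: "K \<subseteq> euclid_ball n R" "K \<noteq> {}"
    and orc: "randomized_oracle n K \<kappa> q S"
    and N: "N = sdp_iterations n m \<kappa> C"
    and run: "\<And>\<omega>. \<omega> \<in> space (oracle_calls N S) \<Longrightarrow> sdp_run n m \<kappa> C \<omega> (X \<omega>)"
begin

lemma iterate_fantope:
  assumes "\<omega> \<in> space (oracle_calls N S)" "1 \<le> k" "k \<le> N"
  shows "X \<omega> k \<in> fantope n m"
  using sdp_run_fantope[OF run[OF assms(1)] nm] assms N by simp

lemma oracle_call_space: "\<omega> \<in> space (oracle_calls N S) \<Longrightarrow> 1 \<le> k \<Longrightarrow> k \<le> N \<Longrightarrow> \<omega> k \<in> space S"
  by (auto simp: oracle_calls_def space_PiM)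

lemma answer_in_K:
  assumes "\<omega> \<in> space (oracle_calls N S)" "1 \<le> k" "k \<le> N"
  shows "\<omega> k (X \<omega> k) \<in> K"
  using randomized_oracleD(2)[OF orc oracle_call_space] iterate_fantope fantope_psd assms by blast

lemma answer_carrier:
  assumes "\<omega> \<in> space (oracle_calls N S)" "1 \<le> k" "k \<le> N"
  shows "\<omega> k (X \<omega> k) \<in> carrier_vec n"
  using answer_in_K[OF assms] K(1) euclid_ballD(1) by blast

text \<open>Both the drawn map and its input are random, so joint measurability of evaluation is
  what is used.\<close>

lemma answer_measurable:
  assumes k: "1 \<le> k" "k \<le> N"
    and X: "\<And>x. x \<in> {..<n} \<times> {..<n} \<Longrightarrow> (\<lambda>\<omega>. X \<omega> k $$ x) \<in> borel_measurable (oracle_calls N S)"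
    and i: "i < n"
  shows "(\<lambda>\<omega>. \<omega> k (X \<omega> k) $ i) \<in> borel_measurable (oracle_calls N S)"
proof (rule vec_borel_index_measurable[OF _ i], rule randomized_oracleD(4)[OF orc])
  show "(\<lambda>\<omega>. \<omega> k) \<in> measurable (oracle_calls N S) S"
    unfolding oracle_calls_def using k by (intro measurable_component_singleton) auto
  show "(\<lambda>\<omega>. X \<omega> k) \<in> measurable (oracle_calls N S) (psd_borel n)"
    by (rule measurable_psd_borelI) (use X fantope_psd[OF iterate_fantope] k in auto)
qed

text \<open>\<open>X\<close> is an arbitrary selection of runs. Inductively, the entries of the next
  iterate are nonexpansive in the unprojected matrix \<open>Y\<close>, whose entries are
  measurable.\<close>

lemma iterate_measurable:
  assumes "1 \<le> k" "k \<le> N" "x \<in> {..<n} \<times> {..<n}"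
  shows "(\<lambda>\<omega>. X \<omega> k $$ x) \<in> borel_measurable (oracle_calls N S)"
  using assms
proof (induction k arbitrary: x rule: dec_induct)
  case base
  have "(\<lambda>\<omega>. X \<omega> 1 $$ x) \<in> borel_measurable (oracle_calls N S)
      \<longleftrightarrow> (\<lambda>\<omega>. (((real n - real m) / real n) \<cdot>\<^sub>m 1\<^sub>m n) $$ x) \<in> borel_measurable (oracle_calls N S)"
    by (rule measurable_cong) (use run in \<open>simp add: sdp_run_def\<close>)
  then show ?case by simp
next
  case (step k)
  have k: "1 \<le> k" "k \<le> N"
    using step by auto
  have X: "(\<lambda>\<omega>. X \<omega> k $$ x) \<in> borel_measurable (oracle_calls N S)" if "x \<in> {..<n} \<times> {..<n}" for x
    using step that by auto
  define Y where "Y \<omega> x = X \<omega> k $$ x - sdp_stepsize \<kappa> C (\<omega> k (X \<omega> k)) * outer n (\<omega> k (X \<omega> k)) $$ x" for \<omega> x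
  have steps: "sdp_step n m \<kappa> C (X \<omega> k) (\<omega> k (X \<omega> k)) (X \<omega> (Suc k))"
    if "\<omega> \<in> space (oracle_calls N S)" for \<omega>
    using run[OF that] k nm N by (auto simp: sdp_run_def)
  show ?case
  proof (rule borel_measurable_nonexpansive[of "{..<n} \<times> {..<n}" Y])
    fix x :: "nat \<times> nat" assume x: "x \<in> {..<n} \<times> {..<n}"
    have out: "outer n p $$ x = p $ fst x * p $ snd x" for p
      using x by (auto simp: outer_def)
    show "(\<lambda>\<omega>. Y \<omega> x) \<in> borel_measurable (oracle_calls N S)"
      unfolding Y_def out
      by (intro borel_measurable_diff borel_measurable_times X x answer_measurable
          borel_measurable_sdp_stepsize[of _ _ n]) (use x k answer_carrier in auto)
  next
    fix \<omega> \<omega>' assume \<omega>: "\<omega> \<in> space (oracle_calls N S)" "\<omega>' \<in> space (oracle_calls N S)"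
    have "(X \<omega> (Suc k) $$ x - X \<omega>' (Suc k) $$ x)\<^sup>2
        \<le> (\<Sum>x\<in>{..<n} \<times> {..<n}. (X \<omega> (Suc k) $$ x - X \<omega>' (Suc k) $$ x)\<^sup>2)"
      using step.prems by (intro member_le_sum) auto
    also have "\<dots> \<le> (\<Sum>x\<in>{..<n} \<times> {..<n}. (Y \<omega> x - Y \<omega>' x)\<^sup>2)"
      unfolding Y_def
      by (rule sdp_step_nonexpansive) (use \<omega> k steps iterate_fantope fantope_carrier in blast)+
    finally show "(X \<omega> (Suc k) $$ x - X \<omega>' (Suc k) $$ x)\<^sup>2 \<le> (\<Sum>x\<in>{..<n} \<times> {..<n}. (Y \<omega> x - Y \<omega>' x)\<^sup>2)" .
  qed
qed

lemma output_SUP_measurable: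
  "(\<lambda>\<omega>. SUP p\<in>K. quad (sdp_output n m \<kappa> C \<omega> (X \<omega>)) p) \<in> borel_measurable (oracle_calls N S)"
proof (rule borel_measurable_SUP_quad[OF K])
  fix x :: "nat \<times> nat" assume x: "x \<in> {..<n} \<times> {..<n}"
  have "(\<lambda>\<omega>. (\<Sum>k = 1..N. sdp_stepsize \<kappa> C (\<omega> k (X \<omega> k)) * X \<omega> k $$ x) /
      (\<Sum>k = 1..N. sdp_stepsize \<kappa> C (\<omega> k (X \<omega> k)))) \<in> borel_measurable (oracle_calls N S)"
    by (intro borel_measurable_divide borel_measurable_sum borel_measurable_times iterate_measurable
        borel_measurable_sdp_stepsize[of _ _ n] answer_measurable) (use x answer_carrier in auto)
  then show "(\<lambda>\<omega>. sdp_output n m \<kappa> C \<omega> (X \<omega>) $$ x) \<in> borel_measurable (oracle_calls N S)"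
    using x nm by (auto simp: sdp_output_def Let_def N)
qed (use nm in \<open>simp add: sdp_output_def Let_def\<close>)

definition failure :: "nat \<Rightarrow> (nat \<Rightarrow> real mat \<Rightarrow> real vec) set" where
  "failure k = {\<omega> \<in> space (oracle_calls N S).
     \<not> inverse \<kappa> * (SUP p\<in>K. quad (X \<omega> k) p) \<le> quad (X \<omega> k) (\<omega> k (X \<omega> k))}"

lemma failure_sets:
  assumes k: "1 \<le> k" "k \<le> N"
  shows "failure k \<in> sets (oracle_calls N S)"
proof -
  have sup: "(\<lambda>\<omega>. SUP p\<in>K. quad (X \<omega> k) p) \<in> borel_measurable (oracle_calls N S)"
    by (rule borel_measurable_SUP_quad[OF K])
      (use k iterate_measurable iterate_fantope fantope_carrier in blast)+
  have quad: "(\<lambda>\<omega>. quad (X \<omega> k) (\<omega> k (X \<omega> k))) \<in> borel_measurable (oracle_calls N S)"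
    by (rule borel_measurable_quad)
      (use k iterate_measurable answer_measurable answer_carrier iterate_fantope fantope_carrier in blast)+
  show ?thesis
    unfolding failure_def not_le using quad sup by (intro borel_measurable_less borel_measurable_times) auto
qed

lemma oracle_failure_prob:
  assumes X0: "X0 \<in> fantope n m"
  shows "measure S {f \<in> space S. \<not> inverse \<kappa> * (SUP p\<in>K. quad X0 p) \<le> quad X0 (f X0)} \<le> q"
proof -
  interpret S: prob_space S
    by (rule randomized_oracleD(1)[OF orc])
  have psd: "psd_mat n X0" and c: "X0 \<in> carrier_mat n n"
    using X0 fantope_psd fantope_carrier by auto
  have fK: "f X0 \<in> carrier_vec n" if "f \<in> space S" for f
    using randomized_oracleD(2)[OF orc that psd] K(1) euclid_ballD(1) by blast
  have "(\<lambda>f. f X0) \<in> measurable S (vec_borel n)"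
    using psd by (intro randomized_oracleD(4)[OF orc]) (auto simp: psd_borel_def)
  then have [measurable]: "(\<lambda>f. quad X0 (f X0)) \<in> borel_measurable S"
    using c fK by (intro borel_measurable_quad) (auto intro: vec_borel_index_measurable)
  have "measure S {f \<in> space S. \<not> inverse \<kappa> * (SUP p\<in>K. quad X0 p) \<le> quad X0 (f X0)}
      = 1 - \<P>(f in S. inverse \<kappa> * (SUP p\<in>K. quad X0 p) \<le> quad X0 (f X0))"
    by (rule S.prob_neg) measurable
  also have "\<dots> \<le> q"
    using randomized_oracleD(3)[OF orc psd] by simp
  finally show ?thesis .
qed

text \<open>With all draws but the k-th frozen, the k-th iterate is constant by
  \<open>sdp_run_cong\<close>, and the slice is the failure event for a fixed input.\<close>

lemma failure_prob:
  assumes k: "1 \<le> k" "k \<le> N"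
  shows "measure (oracle_calls N S) (failure k) \<le> q"
  unfolding oracle_calls_def
proof (rule PiM_prob_le_of_component)
  show S: "prob_space S"
    by (rule randomized_oracleD(1)[OF orc])
  show "failure k \<in> sets (\<Pi>\<^sub>M j\<in>{1..N}. S)"
    using failure_sets[OF k] by (simp add: oracle_calls_def)
  fix x assume x: "x \<in> space (\<Pi>\<^sub>M j\<in>{1..N} - {k}. S)"
  \<comment> \<open>A reference draw in place \<open>k\<close>, used only to name the common value
    of the k-th iterate.\<close>
  obtain y0 where y0: "y0 \<in> space S"
    using prob_space.not_empty[OF S] by auto
  have upd: "x(k := y) \<in> space (oracle_calls N S)" if "y \<in> space S" for y
    using x that k by (auto simp: oracle_calls_def space_PiM PiE_iff extensional_def)
  have eq: "X (x(k := y)) k = X (x(k := y0)) k" if "y \<in> space S" for y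
    using sdp_run_cong[OF run[OF upd[OF that]] run[OF upd[OF y0]] nm k(1)] k N by auto
  have "{y \<in> space S. x(k := y) \<in> failure k}
      = {y \<in> space S. \<not> inverse \<kappa> * (SUP p\<in>K. quad (X (x(k := y0)) k) p)
          \<le> quad (X (x(k := y0)) k) (y (X (x(k := y0)) k))}"
    by (rule Collect_cong) (auto simp: failure_def upd eq)
  then show "measure S {y \<in> space S. x(k := y) \<in> failure k} \<le> q"
    using oracle_failure_prob[OF iterate_fantope[OF upd[OF y0] k]] by simp
qed (use k in auto)

text \<open>Outside \<open>A\<close> at least one call has failed, so the union bound applies to the
  complement.\<close>

lemma success_prob:
  assumes A: "A \<in> sets (oracle_calls N S)"
    and sub: "\<And>\<omega>. \<omega> \<in> space (oracle_calls N S) \<Longrightarrow>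
      (\<And>k. k \<in> {1..N} \<Longrightarrow> inverse \<kappa> * (SUP p\<in>K. quad (X \<omega> k) p) \<le> quad (X \<omega> k) (\<omega> k (X \<omega> k)))
      \<Longrightarrow> \<omega> \<in> A"
  shows "1 - real N * q \<le> measure (oracle_calls N S) A"
proof -
  interpret P: prob_space "oracle_calls N S"
    unfolding oracle_calls_def by (intro prob_space_PiM randomized_oracleD(1)[OF orc])
  have sets: "failure ` {1..N} \<subseteq> sets (oracle_calls N S)"
    using failure_sets by auto
  have "space (oracle_calls N S) - A \<subseteq> (\<Union>k\<in>{1..N}. failure k)"
    using sub unfolding failure_def by blast
  then have "measure (oracle_calls N S) (space (oracle_calls N S) - A)
      \<le> measure (oracle_calls N S) (\<Union>k\<in>{1..N}. failure k)"
    using sets by (intro P.finite_measure_mono) auto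
  also have "\<dots> \<le> (\<Sum>k = 1..N. measure (oracle_calls N S) (failure k))"
    using sets by (intro P.finite_measure_subadditive_finite) auto
  also have "\<dots> \<le> (\<Sum>k = 1..N. q)"
    using failure_prob by (intro sum_mono) auto
  finally show ?thesis
    using P.prob_compl[OF A] by simp
qed

end

section \<open>Combination of the deterministic and the probabilistic bounds\<close>

lemma sdp_output_probability:
  fixes c C L R \<sigma> \<kappa> D r :: real
  assumes c: "c \<ge> 1" and C: "C \<ge> c"
    and N: "N = sdp_iterations n m \<kappa> C" and D: "D = 1 + (2 * R) ^ 3 / \<sigma> ^ 3"
    and L: "L > 0" and n: "n \<ge> 1" and m: "m \<le> n" and \<sigma>: "\<sigma> > 0" and \<kappa>: "\<kappa> \<ge> 1"
    and r: "r > 0" "euclid_ball n r \<subseteq> K" and K: "K \<subseteq> euclid_ball n R"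
    and width: "kolmogorov_width n m K \<le> L * \<kappa> powr (- 1 / 2) * (2 * R) / c"
    and orc: "randomized_oracle n K \<kappa> (inverse (real N) / D) S"
    and run: "\<forall>\<omega> \<in> space (oracle_calls N S). sdp_run n m \<kappa> C \<omega> (X \<omega>)"
  shows "\<P>(\<omega> in oracle_calls N S.
      (SUP p\<in>K. quad (sdp_output n m \<kappa> C \<omega> (X \<omega>)) p) \<le> (4 * L\<^sup>2 + 1) * ((2 * R)\<^sup>2 / c\<^sup>2)) \<ge> 1 - inverse D"
proof -
  \<comment> \<open>A point of norm \<open>r\<close> in \<open>K\<close> forces
    \<open>r \<le> R\<close>, hence \<open>R > 0\<close> and \<open>D > 0\<close>.\<close>
  have "r \<cdot>\<^sub>v unit_vec n 0 \<in> euclid_ball n r"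
    using r(1) n by (simp add: euclid_ball_def vnorm_scaled_unit_vec)
  then have rK: "r \<cdot>\<^sub>v unit_vec n 0 \<in> K"
    using r(2) by blast
  then have "r \<cdot>\<^sub>v unit_vec n 0 \<in> euclid_ball n R"
    using K by blast
  then have R: "R > 0"
    using r(1) n by (simp add: euclid_ball_def vnorm_scaled_unit_vec)
  have Kne: "K \<noteq> {}"
    using rK by blast
  have D0: "D > 0"
    unfolding D using R \<sigma> by (intro add_pos_nonneg) auto
  interpret P: prob_space "oracle_calls N S"
    unfolding oracle_calls_def by (intro prob_space_PiM randomized_oracleD(1)[OF orc])
  show ?thesis
  proof (cases "m = n")
    \<comment> \<open>The output is the zero matrix, so the bound holds surely.\<close>
    case True
    have "(SUP p\<in>K. quad (sdp_output n m \<kappa> C \<omega> (X \<omega>)) p) \<le> (4 * L\<^sup>2 + 1) * ((2 * R)\<^sup>2 / c\<^sup>2)"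
      if \<omega>: "\<omega> \<in> space (oracle_calls N S)" for \<omega>
    proof (rule cSUP_least[OF Kne])
      fix p assume "p \<in> K"
      then have p: "p \<in> carrier_vec n"
        using K euclid_ballD(1) by blast
      have "sdp_output n m \<kappa> C \<omega> (X \<omega>) = 0 \<cdot>\<^sub>m 1\<^sub>m n"
        using run \<omega> True by (simp add: sdp_output_def sdp_run_def)
      then show "quad (sdp_output n m \<kappa> C \<omega> (X \<omega>)) p \<le> (4 * L\<^sup>2 + 1) * ((2 * R)\<^sup>2 / c\<^sup>2)"
        by (simp add: quad_smult_one[OF p])
    qed
    then have "{\<omega> \<in> space (oracle_calls N S).
        (SUP p\<in>K. quad (sdp_output n m \<kappa> C \<omega> (X \<omega>)) p) \<le> (4 * L\<^sup>2 + 1) * ((2 * R)\<^sup>2 / c\<^sup>2)}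
        = space (oracle_calls N S)"
      by auto
    then show ?thesis
      using D0 by (simp add: P.prob_space)
  next
    case False
    then have mn: "m < n" using m by simp
    define b where "b = L * \<kappa> powr (- 1 / 2) * (2 * R) / c"
    have b: "b > 0"
      using L \<kappa> R c by (simp add: b_def)
    \<comment> \<open>Doubling makes the width bound strict, at the price of the factor 4 in the
      constant.\<close>
    have "kolmogorov_width n m K < 2 * b"
      using width b unfolding b_def[symmetric] by linarith
    from near_optimal_fantope[OF m K this] obtain W where W: "W \<in> fantope n m"
      "mat_inner n W W = real n - real m" "\<And>p. p \<in> K \<Longrightarrow> quad W p \<le> (2 * b)\<^sup>2"
      by metis
    \<comment> \<open>The squared width bound carries \<open>1 / \<kappa>\<close>, which cancels the
      factor lost to the oracle.\<close>
    have "(\<kappa> powr (- 1 / 2))\<^sup>2 = inverse \<kappa>"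
      using \<kappa> by (simp add: power2_eq_square powr_minus_divide inverse_eq_divide flip: powr_add)
    then have kb: "\<kappa> * (2 * b)\<^sup>2 = 4 * L\<^sup>2 * ((2 * R)\<^sup>2 / c\<^sup>2)"
      using \<kappa> by (simp add: b_def power_mult_distrib power_divide)
    have "R\<^sup>2 / C\<^sup>2 \<le> (2 * R)\<^sup>2 / c\<^sup>2"
      using c C R by (intro frac_le power_mono) (auto simp: power_mult_distrib)
    \<comment> \<open>In \<open>4 * L^2 + 1\<close> the first summand pays for the doubled width and
      the second, through \<open>c \<le> C\<close>, for the optimization error.\<close>
    then have total: "R\<^sup>2 / C\<^sup>2 + \<kappa> * (2 * b)\<^sup>2 \<le> (4 * L\<^sup>2 + 1) * ((2 * R)\<^sup>2 / c\<^sup>2)"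
      unfolding kb distrib_right mult_1 by (subst add.commute) (rule add_left_mono)
    have N1: "real N > 0"
      by (simp add: N sdp_iterations_def)
    note ctx = n mn K Kne orc N run[rule_format]
    have "1 - real N * (inverse (real N) / D) \<le> measure (oracle_calls N S)
      {\<omega> \<in> space (oracle_calls N S).
        (SUP p\<in>K. quad (sdp_output n m \<kappa> C \<omega> (X \<omega>)) p) \<le> (4 * L\<^sup>2 + 1) * ((2 * R)\<^sup>2 / c\<^sup>2)}"
    proof (rule success_prob[OF ctx])
      show "{\<omega> \<in> space (oracle_calls N S).
        (SUP p\<in>K. quad (sdp_output n m \<kappa> C \<omega> (X \<omega>)) p) \<le> (4 * L\<^sup>2 + 1) * ((2 * R)\<^sup>2 / c\<^sup>2)}
        \<in> sets (oracle_calls N S)"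
        using output_SUP_measurable[OF ctx] by measurable
    next
      fix \<omega> assume \<omega>: "\<omega> \<in> space (oracle_calls N S)"
        and good: "\<And>k. k \<in> {1..N} \<Longrightarrow>
          inverse \<kappa> * (SUP p\<in>K. quad (X \<omega> k) p) \<le> quad (X \<omega> k) (\<omega> k (X \<omega> k))"
      have "(SUP p\<in>K. quad (sdp_output n m \<kappa> C \<omega> (X \<omega>)) p) \<le> R\<^sup>2 / C\<^sup>2 + \<kappa> * (2 * b)\<^sup>2"
        using run \<omega> n mn \<kappa> c C r K R W good answer_in_K[OF ctx \<omega>]
        by (intro sdp_output_bound) (auto simp: N)
      then show "\<omega> \<in> {\<omega> \<in> space (oracle_calls N S).
        (SUP p\<in>K. quad (sdp_output n m \<kappa> C \<omega> (X \<omega>)) p) \<le> (4 * L\<^sup>2 + 1) * ((2 * R)\<^sup>2 / c\<^sup>2)}"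
        using \<omega> total by simp
    qed
    moreover have "real N * (inverse (real N) / D) = inverse D"
      using N1 by (simp add: divide_inverse)
    ultimately show ?thesis
      by (simp only:)
  qed
qed

text \<open>\<open>A\<close> is chosen before \<open>c\<close> and \<open>C\<close> and sees only
  \<open>L\<close>. Quantifying over every selection \<open>X\<close> of runs covers all choices of
  eigendecompositions.\<close>

theorem theorem2p7:
  shows "\<exists>A :: real \<Rightarrow> real. (\<forall>L>0. A L > 0) \<and>
    (\<exists>c0>0. \<forall>c\<ge>c0. \<exists>C0>0. \<forall>C\<ge>C0.
      \<forall>(L::real) (n::nat) (m::nat) (K :: real vec set) (r::real) (R::real) (\<sigma>::real) (\<kappa>::real)
        (S :: (real mat \<Rightarrow> real vec) measure)
        (X :: (nat \<Rightarrow> real mat \<Rightarrow> real vec) \<Rightarrow> nat \<Rightarrow> real mat).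
      let d = 2 * R;
          N = sdp_iterations n m \<kappa> C;
          q = inverse (real N) / (1 + d ^ 3 / \<sigma> ^ 3)
      in
        L > 0 \<longrightarrow> n \<ge> 1 \<longrightarrow> m \<le> n \<longrightarrow> \<sigma> > 0 \<longrightarrow> \<kappa> \<ge> 1 \<longrightarrow>
        convex_body n K \<longrightarrow> origin_symmetric K \<longrightarrow>
        r > 0 \<longrightarrow> euclid_ball n r \<subseteq> K \<longrightarrow> K \<subseteq> euclid_ball n R \<longrightarrow>
        kolmogorov_width n m K \<le> L * \<kappa> powr (- 1 / 2) * d / c \<longrightarrow>
        randomized_oracle n K \<kappa> q S \<longrightarrow>
        (\<forall>\<omega> \<in> space (oracle_calls N S). sdp_run n m \<kappa> C \<omega> (X \<omega>)) \<longrightarrow>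
        \<P>(\<omega> in oracle_calls N S.
            (SUP p \<in> K. quad (sdp_output n m \<kappa> C \<omega> (X \<omega>)) p) \<le> A L * (d\<^sup>2 / c\<^sup>2))
          \<ge> 1 - inverse (1 + d ^ 3 / \<sigma> ^ 3))"
  unfolding Let_def
  \<comment> \<open>The threshold 1 for \<open>c\<close> ensures positivity, and the threshold
    \<open>c\<close> for \<open>C\<close> gives \<open>1 / C^2 \<le> 1 / c^2\<close>.\<close>
  apply (rule exI[of _ "\<lambda>L. 4 * L\<^sup>2 + 1"], rule conjI)
   apply (simp add: add_nonneg_pos)
  apply (rule exI[of _ 1], rule conjI, simp)
  apply (intro allI impI)
  subgoal for c
    apply (rule exI[of _ c], rule conjI, simp)
    apply (intro allI impI)
    subgoal for C
      by (rule sdp_output_probability[of c C]) (assumption | rule refl)+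
    done
  done

end
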